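(* Let $\mu$ be a locally finite complex Borel measure on $[0,1)$ for which $t|\mu|([0,1-t))$ is bounded as $t\to0_+$, and let $D_\mu$ be the continuous derivation on $L^1[0,1)$ given by $D_\mu f=Xf*\mu$ $(f\in L^1[0,1))$. Then $$\overline{D}_{\mu}\nu=X\nu*\mu\qquad(\nu\in M[0,1))$$ extends $D_{\mu}$ to a weak-star continuous, bounded derivation $\overline{D}_{\mu}$ on $M[0,1)$ (in particular $X\nu*\mu\in M[0,1)$ for every $\nu\in M[0,1)$).
   Context: All spaces are complex. $L^1[0,1)$ is the Volterra algebra: the (equivalence classes of) integrable functions on $[0,1)$ with norm $\|f\|=\int_0^1|f(t)|\,dt$ and product $(f*g)(t)=\int_0^t f(s)g(t-s)\,ds$. $M[0,1)$ is the Banach algebra of finite complex Borel measures on $[0,1)$ with total variation norm and convolution truncated to $[0,1)$; $L^1[0,1)$ is regarded as a subalgebra of $M[0,1)$ via $f\mapsto f(t)\,dt$. A measure $\mu$ on $[0,1)$ is here allowed to be only locally finite, i.e. $|\mu|([0,a])<\infty$ for every $a<1$ (a complex Radon measure, where $|\mu|$ is its total variation measure). For locally finite complex measures $\nu,\mu$ on $[0,1)$, the convolution $\nu*\mu$ is the locally finite measure on $[0,1)$ determined by $\int_{[0,1)}h\,d(\nu*\mu)=\int_{[0,1)}\int_{[0,1-t)}h(t+s)\,d\mu(s)\,d\nu(t)$ for continuous $h$ with compact support in $[0,1)$. $X$ is multiplication by the coordinate: $(Xf)(t)=tf(t)$ for functions and $d(X\nu)(t)=t\,d\nu(t)$ for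 measures. A derivation on an algebra $\mathcal B$ is a linear map $D:\mathcal B\to\mathcal B$ with $D(a*b)=D(a)*b+a*D(b)$. It is known that for $\mu$ as in the statement, $D_\mu$ is a continuous derivation on $L^1[0,1)$. $C_0[0,1)$ is the Banach space of continuous functions $h$ on $[0,1]$ with $h(1)=0$ and the supremum norm. $M[0,1)$ is identified with the dual of $C_0[0,1)$ via $\langle h,\mu\rangle=\int_{[0,1)}h\,d\mu$, and "weak-star" refers to this duality, i.e. to the topology $\sigma(M[0,1),C_0[0,1))$. *)

theory Defs
  imports "HOL-Analysis.Analysis"
begin

abbreviation borel01 :: "real set set" where
  "borel01 \<equiv> sets (restrict_space borel {0..<1})"

text \<open>
  A complex measure on \<open>[0,1)\<close> is a set function on the Borel subsets of \<open>[0,1)\<close>.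
  For a measure that is only locally finite, the value at \<open>A\<close> is meaningful exactly when the
  total variation of \<open>A\<close> is finite; by convention it is \<open>0\<close> otherwise, and also at sets that
  are not Borel subsets of \<open>[0,1)\<close>. With this convention HOL equality of set functions is
  equality of measures.
\<close>

type_synonym cmeasure = "real set \<Rightarrow> complex"

definition variation_on :: "cmeasure \<Rightarrow> real set \<Rightarrow> ennreal" where
  "variation_on \<mu> A =
     (SUP P \<in> {P. finite P \<and> partition_on A P \<and> P \<subseteq> borel01}. \<Sum>B\<in>P. ennreal (norm (\<mu> B)))"

definition locally_finite_measures :: "cmeasure set" where
  "locally_finite_measures = {\<mu>.
     (\<forall>A. A \<notin> borel01 \<or> variation_on \<mu> A = \<infinity> \<longrightarrow> \<mu> A = 0) \<and>
     (\<forall>a<1. variation_on \<mu> {0..a} < \<infinity>) \<and>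
     (\<forall>A. range A \<subseteq> borel01 \<longrightarrow> disjoint_family A \<longrightarrow> variation_on \<mu> (\<Union>n. A n) < \<infinity> \<longrightarrow>
        (\<lambda>n::nat. \<mu> (A n)) sums \<mu> (\<Union>n. A n))}"

text \<open>The total variation measure \<open>|\<mu>|\<close>.\<close>

definition variation :: "cmeasure \<Rightarrow> real measure" where
  "variation \<mu> = measure_of {0..<1} borel01 (variation_on \<mu>)"

text \<open>
  \<open>M[0,1)\<close>. On these set functions the conventions above only concern non-Borel arguments,
  so they are the countably additive complex set functions on the Borel subsets of \<open>[0,1)\<close>.
\<close>

definition finite_measures :: "cmeasure set" where
  "finite_measures = {\<nu> \<in> locally_finite_measures. variation_on \<nu> {0..<1} < \<infinity>}"

definition mnorm :: "cmeasure \<Rightarrow> real" where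
  "mnorm \<nu> = measure (variation \<nu>) {0..<1}"

text \<open>
  Integration against \<open>\<mu>\<close> is through the polar decomposition \<open>d\<mu> = \<phi> d|\<mu>|\<close>. The density \<open>\<phi>\<close>
  is determined up to \<open>|\<mu>|\<close>-null sets (and has modulus \<open>1\<close> almost everywhere), so the integral
  does not depend on the choice.
\<close>

definition polar_density :: "cmeasure \<Rightarrow> real \<Rightarrow> complex" where
  "polar_density \<mu> = (SOME \<phi>. \<phi> \<in> borel_measurable (variation \<mu>) \<and>
     (\<forall>A\<in>borel01. variation_on \<mu> A < \<infinity> \<longrightarrow>
        set_integrable (variation \<mu>) A \<phi> \<and> \<mu> A = (LINT x:A|variation \<mu>. \<phi> x)))"

definition cint :: "cmeasure \<Rightarrow> real set \<Rightarrow> (real \<Rightarrow> complex) \<Rightarrow> complex" where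
  "cint \<mu> S h = (LINT x:S|variation \<mu>. h x * polar_density \<mu> x)"

definition Cc01 :: "(real \<Rightarrow> complex) set" where
  "Cc01 = {h. continuous_on {0..<1} h \<and>
     (\<exists>K. compact K \<and> K \<subseteq> {0..<1} \<and> (\<forall>t\<in>{0..<1} - K. h t = 0))}"

definition convolution :: "cmeasure \<Rightarrow> cmeasure \<Rightarrow> cmeasure" where
  "convolution \<nu> \<mu> = (THE \<rho>. \<rho> \<in> locally_finite_measures \<and>
     (\<forall>h\<in>Cc01. cint \<rho> {0..<1} h = cint \<nu> {0..<1} (\<lambda>t. cint \<mu> {0..<1 - t} (\<lambda>s. h (t + s)))))"

definition Xmult :: "cmeasure \<Rightarrow> cmeasure" where
  "Xmult \<nu> A = (if A \<in> borel01 then cint \<nu> A (\<lambda>t. of_real t) else 0)"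

definition Dbar :: "cmeasure \<Rightarrow> cmeasure \<Rightarrow> cmeasure" where
  "Dbar \<mu> \<nu> = convolution (Xmult \<nu>) \<mu>"

text \<open>
  Elements of \<open>L\<^sup>1[0,1)\<close> are given by Borel measurable representatives (every class has one).
  Two representatives agree almost everywhere iff they define the same measure \<open>f(t) dt\<close>.
\<close>

definition L1 :: "(real \<Rightarrow> complex) set" where
  "L1 = {f. set_integrable lborel {0..<1} f}"

definition L1_measure :: "(real \<Rightarrow> complex) \<Rightarrow> cmeasure" where
  "L1_measure f A = (if A \<in> borel01 then (LINT t:A|lborel. f t) else 0)"

text \<open>
  \<open>D\<^sub>\<mu> f = Xf * \<mu>\<close> as a function, using \<open>(g * \<mu>)(t) = \<integral>\<^bsub>[0,t]\<^esub> g(t - s) d\<mu>(s)\<close> for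
  almost every \<open>t\<close>.
\<close>

definition D_L1 :: "cmeasure \<Rightarrow> (real \<Rightarrow> complex) \<Rightarrow> real \<Rightarrow> complex" where
  "D_L1 \<mu> f t = cint \<mu> {0..t} (\<lambda>s. of_real (t - s) * f (t - s))"

definition derivation_on_M :: "(cmeasure \<Rightarrow> cmeasure) \<Rightarrow> bool" where
  "derivation_on_M D \<longleftrightarrow>
     (\<forall>a\<in>finite_measures. D a \<in> finite_measures) \<and>
     (\<forall>a\<in>finite_measures. \<forall>b\<in>finite_measures.
        D (\<lambda>A. a A + b A) = (\<lambda>A. D a A + D b A)) \<and>
     (\<forall>c. \<forall>a\<in>finite_measures. D (\<lambda>A. c * a A) = (\<lambda>A. c * D a A)) \<and>
     (\<forall>a\<in>finite_measures. \<forall>b\<in>finite_measures.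
        D (convolution a b) = (\<lambda>A. convolution (D a) b A + convolution a (D b) A))"

definition bounded_on_M :: "(cmeasure \<Rightarrow> cmeasure) \<Rightarrow> bool" where
  "bounded_on_M D \<longleftrightarrow> (\<exists>C. \<forall>\<nu>\<in>finite_measures. mnorm (D \<nu>) \<le> C * mnorm \<nu>)"

definition C0 :: "(real \<Rightarrow> complex) set" where
  "C0 = {h. continuous_on {0..1} h \<and> h 1 = 0}"

definition weak_star :: "cmeasure topology" where
  "weak_star = topology_generated_by
     {{\<nu> \<in> finite_measures. cint \<nu> {0..<1} h \<in> U} | h U. h \<in> C0 \<and> open U}"

end

theory Submission
  imports Defs
begin

text \<open>
  A finite measure \<open>\<nu>\<close> is treated as a functional on bounded Borel functions, and conversely a
  norm-bounded linear functional that respects bounded pointwise limits is a finite measure.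
  Put \<open>(P h)(t) = t \<integral>\<^bsub>[0,1-t)\<^esub> h(t + s) d\<mu>(s)\<close>. The growth condition on \<open>|\<mu>|\<close> says exactly
  that \<open>P\<close> maps bounded functions to bounded functions, and \<open>D\<close> is the transpose of \<open>P\<close>:
  \<open>\<langle>h, D\<nu>\<rangle> = \<langle>P h, \<nu>\<rangle>\<close>. This gives boundedness; weak-star continuity holds because \<open>P\<close> preserves
  \<open>C\<^sub>0[0,1)\<close>; the product rule holds because the coordinate is additive, \<open>X\<close> being the
  factor \<open>t + u\<close> under a double integral whose order may be exchanged by Fubini's theorem.
\<close>

section \<open>The total variation measure\<close>

text \<open>Two mismatches shape the argument. \<open>convolution\<close> is a definite description
  tested only on \<open>Cc01\<close>, while the product rule and the norm bound call for all bounded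
  Borel tests. So a locally finite measure must first be shown to be determined by its integrals
  over \<open>Cc01\<close>; each convolution is then identified with A |-> L(1_A) for a functional L
  on bounded Borel functions, indicators being tests themselves.

  Moreover \<mu> may have infinite mass: the inner integral of P h may diverge at t = 0 and blow up
  as t tends to 0, and only its product with t is controlled. Hence facts about the inner integral
  carry a finiteness hypothesis on [0,1 - t) or a support condition on h. Continuity of P h at 0
  comes from h vanishing at 1, and Fubini in the product rule from t <= t + u, which bounds t q(t +
  u) by (t + u) |q(t + u)| even where q is unbounded.

  The polar density is bounded by 2 in place of its true modulus 1. Each integration against one
  costs a factor 2, so the final norm bound is 4 C.\<close>

lemma borel01_iff: "A \<in> borel01 \<longleftrightarrow> A \<in> sets borel \<and> A \<subseteq> {0..<1}"
  by (subst sets_restrict_space_iff) auto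

lemma variation_on_ge:
  assumes "finite P" "partition_on A P" "P \<subseteq> borel01"
  shows "(\<Sum>B\<in>P. ennreal (norm (\<mu> B))) \<le> variation_on \<mu> A"
  unfolding variation_on_def using assms by (intro SUP_upper) auto

lemma variation_on_leI:
  assumes "\<And>P. finite P \<Longrightarrow> partition_on A P \<Longrightarrow> P \<subseteq> borel01 \<Longrightarrow>
    (\<Sum>B\<in>P. ennreal (norm (\<mu> B))) \<le> c"
  shows "variation_on \<mu> A \<le> c"
  unfolding variation_on_def using assms by (intro SUP_least) auto

lemma variation_on_empty [simp]: "variation_on \<mu> {} = 0"
proof -
  have "variation_on \<mu> {} \<le> 0"
    by (rule variation_on_leI) (auto simp: partition_on_empty)
  then show ?thesis by simp
qed

lemma borel01_partition_exists:
  assumes "A \<in> borel01"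
  shows "\<exists>P. finite P \<and> partition_on A P \<and> P \<subseteq> borel01"
proof (cases "A = {}")
  case True
  then show ?thesis by (intro exI[of _ "{}"]) (auto simp: partition_on_empty)
next
  case False
  then show ?thesis using assms by (intro exI[of _ "{A}"]) (auto simp: partition_on_space)
qed

text \<open>The one-block partition {A} gives the bound. Partitions have no empty block, so A = {}
  is separate and accounts for the hypothesis on \<open>\<mu> {}\<close>.\<close>

lemma norm_le_variation_on:
  assumes "A \<in> borel01" "\<mu> {} = 0"
  shows "ennreal (norm (\<mu> A)) \<le> variation_on \<mu> A"
proof (cases "A = {}")
  case False
  then show ?thesis
    using variation_on_ge[of "{A}" A \<mu>] assms by (simp add: partition_on_space)
qed (use assms in simp)

text \<open>A partition of A and one of B together form a partition of the disjoint union; the two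
  suprema are then taken one after the other.\<close>

lemma variation_on_superadd:
  assumes "A \<in> borel01" "B \<in> borel01" "A \<inter> B = {}"
  shows "variation_on \<mu> A + variation_on \<mu> B \<le> variation_on \<mu> (A \<union> B)"
proof -
  let ?P = "\<lambda>A. {P. finite P \<and> partition_on A P \<and> P \<subseteq> borel01}"
  let ?s = "\<lambda>P. \<Sum>B\<in>P. ennreal (norm (\<mu> B))"
  have le: "?s P + ?s Q \<le> variation_on \<mu> (A \<union> B)" if P: "P \<in> ?P A" and Q: "Q \<in> ?P B" for P Q
  proof -
    have P': "\<Union>P = A" "disjoint P" "{} \<notin> P" and Q': "\<Union>Q = B" "disjoint Q" "{} \<notin> Q"
      using P Q by (auto simp: partition_on_def)
    have "C = {}" if "C \<in> P" "C \<in> Q" for C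
      using that P'(1) Q'(1) assms(3) by blast
    then have "P \<inter> Q = {}"
      using P'(3) by blast
    moreover have "partition_on (A \<union> B) (P \<union> Q)"
      unfolding partition_on_def
    proof (intro conjI)
      show "disjoint (P \<union> Q)"
        using P'(1,2) Q'(1,2) assms(3) by (intro disjoint_union) auto
    qed (use P' Q' in auto)
    ultimately have "?s P + ?s Q = ?s (P \<union> Q)"
      and "?s (P \<union> Q) \<le> variation_on \<mu> (A \<union> B)"
      using P Q variation_on_ge[of "P \<union> Q" "A \<union> B" \<mu>]
      by (simp_all add: sum.union_disjoint del: sum_ennreal)
    then show ?thesis by simp
  qed
  have ne: "?P A \<noteq> {}" "?P B \<noteq> {}"
    using borel01_partition_exists assms(1,2) by blast+
  have "variation_on \<mu> A + variation_on \<mu> B = (SUP P\<in>?P A. ?s P + variation_on \<mu> B)"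
    unfolding variation_on_def[of \<mu> A] by (rule ennreal_SUP_add_left[OF ne(1), symmetric])
  also have "\<dots> \<le> variation_on \<mu> (A \<union> B)"
  proof (rule SUP_least)
    fix P assume P: "P \<in> ?P A"
    have "?s P + variation_on \<mu> B = (SUP Q\<in>?P B. ?s P + ?s Q)"
      unfolding variation_on_def by (rule ennreal_SUP_add_right[OF ne(2)])
    also have "\<dots> \<le> variation_on \<mu> (A \<union> B)"
      by (rule SUP_least) (rule le[OF P])
    finally show "?s P + variation_on \<mu> B \<le> variation_on \<mu> (A \<union> B)" .
  qed
  finally show ?thesis .
qed

lemma variation_on_mono:
  assumes "A \<in> borel01" "B \<in> borel01" "A \<subseteq> B"
  shows "variation_on \<mu> A \<le> variation_on \<mu> B"
proof -
  have "variation_on \<mu> A \<le> variation_on \<mu> A + variation_on \<mu> (B - A)"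
    by simp
  also have "\<dots> \<le> variation_on \<mu> (A \<union> (B - A))"
    using assms by (intro variation_on_superadd) (auto simp: borel01_iff)
  finally show ?thesis
    using assms by (simp add: Un_absorb1)
qed

lemma variation_on_sum_le:
  assumes "finite I" "\<And>i. i \<in> I \<Longrightarrow> B i \<in> borel01" "disjoint_family_on B I"
  shows "(\<Sum>i\<in>I. variation_on \<mu> (B i)) \<le> variation_on \<mu> (\<Union>i\<in>I. B i)"
  using assms
proof (induction I rule: finite_induct)
  case (insert i I)
  have dis: "B i \<inter> (\<Union>j\<in>I. B j) = {}"
    using insert.hyps insert.prems(2) by (auto simp: disjoint_family_on_def)
  have "(\<Sum>j\<in>insert i I. variation_on \<mu> (B j)) \<le> variation_on \<mu> (B i) + variation_on \<mu> (\<Union>j\<in>I. B j)"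
    using insert by (auto simp: disjoint_family_on_def intro!: add_mono)
  also have "\<dots> \<le> variation_on \<mu> (B i \<union> (\<Union>j\<in>I. B j))"
    using insert dis by (intro variation_on_superadd sets.finite_UN) auto
  finally show ?case by simp
qed simp

text \<open>Some \<open>B i\<close> may be empty, even for several indices, and then the family is
  not a partition of its union. The detour through the variation of each \<open>B i\<close> absorbs
  this.\<close>

lemma sum_le_variation_on:
  assumes "finite I" "\<And>i. i \<in> I \<Longrightarrow> B i \<in> borel01" "disjoint_family_on B I"
    and "A \<in> borel01" "(\<Union>i\<in>I. B i) \<subseteq> A" "\<mu> {} = 0"
  shows "(\<Sum>i\<in>I. ennreal (norm (\<mu> (B i)))) \<le> variation_on \<mu> A"
proof -
  have "(\<Sum>i\<in>I. ennreal (norm (\<mu> (B i)))) \<le> (\<Sum>i\<in>I. variation_on \<mu> (B i))"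
    using assms by (intro sum_mono norm_le_variation_on) auto
  also have "\<dots> \<le> variation_on \<mu> (\<Union>i\<in>I. B i)"
    using assms by (intro variation_on_sum_le)
  also have "\<dots> \<le> variation_on \<mu> A"
    using assms by (intro variation_on_mono sets.finite_UN) auto
  finally show ?thesis .
qed

lemma sums_norm_le_suminf:
  fixes f :: "nat \<Rightarrow> 'a::real_normed_vector"
  assumes "f sums s"
  shows "ennreal (norm s) \<le> (\<Sum>i. ennreal (norm (f i)))"
proof -
  have lim: "(\<lambda>n. ennreal (norm (\<Sum>i<n. f i))) \<longlonglongrightarrow> ennreal (norm s)"
    using assms by (intro tendsto_ennrealI tendsto_norm) (simp add: sums_def)
  have bound: "ennreal (norm (\<Sum>i<n. f i)) \<le> (\<Sum>i. ennreal (norm (f i)))" for n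
  proof -
    have "ennreal (norm (\<Sum>i<n. f i)) \<le> (\<Sum>i<n. ennreal (norm (f i)))"
      by (subst sum_ennreal) (auto intro!: ennreal_leI norm_sum)
    also have "\<dots> \<le> (\<Sum>i. ennreal (norm (f i)))"
      by (intro sum_le_suminf) auto
    finally show ?thesis .
  qed
  from lim show ?thesis
    by (rule Lim_bounded) (intro allI impI bound)
qed

section \<open>Countable additivity of the total variation\<close>

locale lfin_measure =
  fixes \<mu> :: cmeasure
  assumes locally_finite: "\<mu> \<in> locally_finite_measures"
begin

lemma eq_0: "A \<notin> borel01 \<or> variation_on \<mu> A = \<infinity> \<Longrightarrow> \<mu> A = 0"
  using locally_finite unfolding locally_finite_measures_def by blast

lemma variation_on_compact_finite: "a < 1 \<Longrightarrow> variation_on \<mu> {0..a} < \<infinity>"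
  using locally_finite unfolding locally_finite_measures_def by blast

lemma sums_UN:
  assumes "range A \<subseteq> borel01" "disjoint_family A" "variation_on \<mu> (\<Union>n::nat. A n) < \<infinity>"
  shows "(\<lambda>n. \<mu> (A n)) sums \<mu> (\<Union>n. A n)"
  using locally_finite assms unfolding locally_finite_measures_def by blast

text \<open>The empty set is a disjoint union of infinitely many copies of itself, and a constant
  series converges only if its term is 0.\<close>

lemma empty [simp]: "\<mu> {} = 0"
proof -
  have "(\<lambda>n::nat. \<mu> {}) sums \<mu> (\<Union>n::nat. {})"
    by (rule sums_UN) (auto simp: disjoint_family_on_def borel01_iff)
  then show ?thesis
    using sums_summable summable_const_iff by blast
qed

text \<open>One inequality is finite superadditivity and monotonicity. For the other, each block of
  a finite partition is cut along the \<open>A n\<close>, countable additivity and the triangle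
  inequality bound its value, and the finite sum over blocks is exchanged with the series.\<close>

lemma variation_on_UN:
  assumes A: "range A \<subseteq> borel01" "disjoint_family A"
  shows "variation_on \<mu> (\<Union>n::nat. A n) = (\<Sum>n. variation_on \<mu> (A n))"
proof (rule antisym)
  have UN: "(\<Union>n. A n) \<in> borel01"
    using A(1) by (intro sets.countable_UN) auto
  show "(\<Sum>n. variation_on \<mu> (A n)) \<le> variation_on \<mu> (\<Union>n. A n)"
  proof (intro suminf_le_const summableI)
    fix n
    have "(\<Sum>i<n. variation_on \<mu> (A i)) \<le> variation_on \<mu> (\<Union>i<n. A i)"
      using A by (intro variation_on_sum_le) (auto simp: disjoint_family_on_def)
    also have "\<dots> \<le> variation_on \<mu> (\<Union>n. A n)"
      using A by (intro variation_on_mono UN sets.finite_UN) auto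
    finally show "(\<Sum>i<n. variation_on \<mu> (A i)) \<le> variation_on \<mu> (\<Union>n. A n)" .
  qed
  show "variation_on \<mu> (\<Union>n. A n) \<le> (\<Sum>n. variation_on \<mu> (A n))"
  proof (rule variation_on_leI)
    fix P assume P: "finite P" "partition_on (\<Union>n. A n) P" "P \<subseteq> borel01"
    have "ennreal (norm (\<mu> B)) \<le> (\<Sum>n. ennreal (norm (\<mu> (B \<inter> A n))))" if "B \<in> P" for B
    \<comment> \<open>A block of infinite variation has value 0 by convention; countable additivity
      is available only for the other blocks.\<close>
    proof (cases "variation_on \<mu> B = \<infinity>")
      case False
      have B: "B \<in> borel01" "(\<Union>n. B \<inter> A n) = B"
      proof -
        show "B \<in> borel01" using that P(3) by (rule subsetD[rotated])
        have "B \<subseteq> (\<Union>n. A n)" using that partition_onD1[OF P(2)] by (simp add: Union_upper)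
        then show "(\<Union>n. B \<inter> A n) = B" by blast
      qed
      have "(\<lambda>n. \<mu> (B \<inter> A n)) sums \<mu> (\<Union>n. B \<inter> A n)"
      proof (rule sums_UN)
        show "variation_on \<mu> (\<Union>n. B \<inter> A n) < \<infinity>"
          using False by (simp only: B(2) infinity_ennreal_def less_top)
      qed (use A B(1) in \<open>auto simp: disjoint_family_on_def\<close>)
      from sums_norm_le_suminf[OF this] show ?thesis
        unfolding B(2) .
    qed (simp add: eq_0)
    then have "(\<Sum>B\<in>P. ennreal (norm (\<mu> B))) \<le> (\<Sum>B\<in>P. \<Sum>n. ennreal (norm (\<mu> (B \<inter> A n))))"
      by (intro sum_mono)
    also have "\<dots> = (\<Sum>n. \<Sum>B\<in>P. ennreal (norm (\<mu> (B \<inter> A n))))"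
      by (intro suminf_sum[symmetric]) simp
    also have "\<dots> \<le> (\<Sum>n. variation_on \<mu> (A n))"
    proof (intro suminf_le summableI sum_le_variation_on)
      fix n
      show "disjoint_family_on (\<lambda>B. B \<inter> A n) P"
        using P(2) unfolding partition_on_def disjoint_family_on_def disjoint_def by blast
      show "finite P" by (rule P(1))
      show "B \<inter> A n \<in> borel01" if "B \<in> P" for B
        using that A(1) P(3) by (intro sets.Int) blast+
      show "A n \<in> borel01" "(\<Union>B\<in>P. B \<inter> A n) \<subseteq> A n" "\<mu> {} = 0"
        using A(1) by auto
    qed
    finally show "(\<Sum>B\<in>P. ennreal (norm (\<mu> B))) \<le> (\<Sum>n. variation_on \<mu> (A n))" .
  qed
qed

lemma space_variation [simp]: "space (variation \<mu>) = {0..<1}"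
  and sets_variation [simp, measurable_cong]: "sets (variation \<mu>) = borel01"
proof -
  have "borel01 \<subseteq> Pow {0..<1}" unfolding subset_iff borel01_iff by blast
  moreover have "sigma_algebra {0..<1::real} borel01"
    using sets.sigma_algebra_axioms[of "restrict_space borel {0..<1::real}"] by simp
  ultimately show "space (variation \<mu>) = {0..<1}" "sets (variation \<mu>) = borel01"
    unfolding variation_def
    by (simp_all only: space_measure_of sigma_algebra.sets_measure_of_eq)
qed

lemma emeasure_variation: "A \<in> borel01 \<Longrightarrow> emeasure (variation \<mu>) A = variation_on \<mu> A"
  unfolding variation_def
proof (rule emeasure_measure_of_sigma)
  show "sigma_algebra {0..<1::real} borel01"
    using sets.sigma_algebra_axioms[of "restrict_space borel {0..<1::real}"] by simp
  show "countably_additive borel01 (variation_on \<mu>)"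
    by (auto simp: countably_additive_def variation_on_UN)
qed (auto simp: positive_def)

end

section \<open>The polar density\<close>

text \<open>Compact intervals increasing to [0,1). Local finiteness bounds the variation on each of
  them, so they witness sigma-finiteness of |\<mu>|.\<close>

definition exhaustion :: "nat \<Rightarrow> real set" where
  "exhaustion n = {0..1 - 1 / real (Suc n)}"

lemma exhaustion_borel01 [simp, measurable]: "exhaustion n \<in> borel01"
proof -
  have "1 - 1 / real (Suc n) < 1" by simp
  then have "{0..1 - 1 / real (Suc n)} \<subseteq> {0..<1}"
    unfolding subset_iff atLeastAtMost_iff atLeastLessThan_iff by (meson le_less_trans)
  then show ?thesis
    by (simp add: borel01_iff exhaustion_def)
qed

lemma UN_exhaustion: "(\<Union>n. exhaustion n) = {0..<1}"
proof (intro equalityI subsetI)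
  fix x :: real assume x: "x \<in> {0..<1}"
  obtain n where "inverse (real (Suc n)) < 1 - x"
    using reals_Archimedean[of "1 - x"] x by auto
  then have "x \<in> exhaustion n"
    using x by (simp add: exhaustion_def inverse_eq_divide)
  then show "x \<in> (\<Union>n. exhaustion n)" by blast
next
  fix x assume "x \<in> (\<Union>n. exhaustion n)"
  then show "x \<in> {0..<1}"
    using exhaustion_borel01 unfolding borel01_iff by blast
qed

lemma borel01_subset: "A \<in> borel01 \<Longrightarrow> A \<subseteq> {0..<1}"
  by (simp add: borel01_iff)

text \<open>Splits a Borel set into countably many disjoint pieces inside compact intervals.
  Questions about sets of possibly infinite variation are reduced to these pieces.\<close>

lemma disjointed_exhaustion:
  shows disjointed_exhaustion_borel01: "disjointed exhaustion n \<in> borel01"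
    and UN_Int_disjointed_exhaustion: "A \<in> borel01 \<Longrightarrow> (\<Union>n. A \<inter> disjointed exhaustion n) = A"
    and disjoint_Int_disjointed_exhaustion: "disjoint_family (\<lambda>n. A \<inter> disjointed exhaustion n)"
proof -
  have "range exhaustion \<subseteq> borel01"
    by (rule image_subsetI) simp
  from sets.range_disjointed_sets[OF this] show "disjointed exhaustion n \<in> borel01" by blast
  show "(\<Union>n. A \<inter> disjointed exhaustion n) = A" if "A \<in> borel01"
    using borel01_subset[OF that]
    by (simp only: Int_UN_distrib[symmetric] UN_disjointed_eq UN_exhaustion Int_absorb2)
  show "disjoint_family (\<lambda>n. A \<inter> disjointed exhaustion n)"
    using disjoint_family_disjointed[of exhaustion] unfolding disjoint_family_on_def by blast
qed

context lfin_measure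
begin

lemma emeasure_exhaustion_finite: "emeasure (variation \<mu>) (exhaustion n) < \<infinity>"
proof -
  have "variation_on \<mu> (exhaustion n) < \<infinity>"
    unfolding exhaustion_def by (rule variation_on_compact_finite) simp
  then show ?thesis by (simp add: emeasure_variation)
qed

sublocale variation: sigma_finite_measure "variation \<mu>"
proof
  show "\<exists>A. countable A \<and> A \<subseteq> sets (variation \<mu>) \<and> \<Union>A = space (variation \<mu>) \<and>
      (\<forall>a\<in>A. emeasure (variation \<mu>) a \<noteq> \<infinity>)"
    using emeasure_exhaustion_finite
    by (intro exI[of _ "range exhaustion"]) (auto simp: UN_exhaustion less_top[symmetric])
qed

text \<open>\<open>Radon_Nikodym\<close> asks for a positive measure on all Borel sets, while
  \<kappa> is signed and controlled only on sets of finite variation. The bound makes |\<mu>| +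
  \<kappa> nonnegative there, summation over disjoint pieces extends it to all Borel sets, and
  subtracting 1 from its density leaves a density of \<kappa>.\<close>

lemma real_density_exists:
  fixes \<kappa> :: "real set \<Rightarrow> real"
  assumes bound: "\<And>A. A \<in> borel01 \<Longrightarrow> variation_on \<mu> A < \<infinity> \<Longrightarrow> \<bar>\<kappa> A\<bar> \<le> measure (variation \<mu>) A"
    and sums: "\<And>A. range A \<subseteq> borel01 \<Longrightarrow> disjoint_family A \<Longrightarrow>
      variation_on \<mu> (\<Union>n::nat. A n) < \<infinity> \<Longrightarrow> (\<lambda>n. \<kappa> (A n)) sums \<kappa> (\<Union>n. A n)"
  shows "\<exists>f\<in>borel_measurable (variation \<mu>). \<forall>A\<in>borel01. variation_on \<mu> A < \<infinity> \<longrightarrow>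
    set_integrable (variation \<mu>) A f \<and> \<kappa> A = (LINT x:A|variation \<mu>. f x)"
proof -
  let ?m = "variation \<mu>"
  define pos where "pos A = measure ?m A + \<kappa> A" for A
  define J where "J = disjointed exhaustion"
  have J: "J n \<in> borel01" for n
    unfolding J_def by (rule disjointed_exhaustion_borel01)
  have fin_sub: "variation_on \<mu> A < \<infinity>" if "A \<in> borel01" "B \<in> borel01" "A \<subseteq> B" "variation_on \<mu> B < \<infinity>" for A B
    using variation_on_mono[OF that(1-3)] that(4) by (rule le_less_trans)
  have fin_exh: "variation_on \<mu> (exhaustion n) < \<infinity>" for n
    using emeasure_exhaustion_finite[of n] by (simp add: emeasure_variation)
  have fin_J: "variation_on \<mu> (A \<inter> J n) < \<infinity>" if "A \<in> borel01" for A n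
    using J[of n] that by (intro fin_sub[OF _ _ _ fin_exh[of n]])
      (auto simp: J_def disjointed_def)
  have pos_nonneg: "0 \<le> pos A" if "A \<in> borel01" "variation_on \<mu> A < \<infinity>" for A
    using bound[OF that] by (simp add: pos_def)
  have pos_sums: "(\<lambda>n. pos (A n)) sums pos (\<Union>n. A n)"
    if "range A \<subseteq> borel01" "disjoint_family A" "variation_on \<mu> (\<Union>n::nat. A n) < \<infinity>" for A
  proof -
    have "(\<Union>n. A n) \<in> borel01"
      using that(1) by (intro sets.countable_UN)
    then have "emeasure ?m (\<Union>n. A n) \<noteq> \<infinity>"
      using that(3) by (simp add: emeasure_variation)
    then show ?thesis
      unfolding pos_def using that by (intro sums_add measure_UNION sums) simp_all
  qed
  \<comment> \<open>On a set of infinite variation \<open>pos\<close> carries no information; on the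
    pieces \<open>A \<inter> J n\<close> it does, and \<open>N\<close> sums them in the extended
    reals.\<close>
  define N where "N A = (\<Sum>n. ennreal (pos (A \<inter> J n)))" for A
  have N_eq: "N A = ennreal (pos A)" if A: "A \<in> borel01" "variation_on \<mu> A < \<infinity>" for A
  proof -
    have eq: "(\<Union>n. A \<inter> J n) = A"
      unfolding J_def by (rule UN_Int_disjointed_exhaustion[OF A(1)])
    have "(\<lambda>n. pos (A \<inter> J n)) sums pos (\<Union>n. A \<inter> J n)"
    proof (rule pos_sums)
      show "range (\<lambda>n. A \<inter> J n) \<subseteq> borel01"
        using A(1) J by auto
      show "disjoint_family (\<lambda>n. A \<inter> J n)"
        unfolding J_def by (rule disjoint_Int_disjointed_exhaustion)
    qed (simp only: eq A(2))
    then show ?thesis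
      unfolding N_def eq using A fin_J J by (intro suminf_ennreal_eq pos_nonneg) auto
  qed
  define NM where "NM = measure_of {0..<1} borel01 N"
  have sa: "sigma_algebra {0..<1::real} borel01"
    using sets.sigma_algebra_axioms[of "restrict_space borel {0..<1::real}"] by simp
  have "borel01 \<subseteq> Pow {0..<1}" unfolding subset_iff borel01_iff by blast
  then have sets_NM: "sets NM = borel01"
    unfolding NM_def using sa by (simp only: sigma_algebra.sets_measure_of_eq)
  have "countably_additive borel01 N"
    unfolding countably_additive_def
  proof (intro allI impI)
    fix A :: "nat \<Rightarrow> real set"
    assume A: "range A \<subseteq> borel01" "disjoint_family A" "(\<Union>n. A n) \<in> borel01"
    \<comment> \<open>The double series is reordered by reading one of its sums as an integral
      against counting measure.\<close>
    have "(\<Sum>i. N (A i)) = (\<Sum>i. \<integral>\<^sup>+n. ennreal (pos (A i \<inter> J n)) \<partial>count_space UNIV)"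
      by (simp add: N_def nn_integral_count_space_nat)
    also have "\<dots> = (\<integral>\<^sup>+n. (\<Sum>i. ennreal (pos (A i \<inter> J n))) \<partial>count_space UNIV)"
      by (rule nn_integral_suminf[symmetric]) simp
    also have "\<dots> = (\<Sum>n. \<Sum>i. ennreal (pos (A i \<inter> J n)))"
      by (simp add: nn_integral_count_space_nat)
    also have "\<dots> = N (\<Union>n. A n)"
    proof -
      have "(\<Sum>i. ennreal (pos (A i \<inter> J n))) = ennreal (pos ((\<Union>n. A n) \<inter> J n))" for n
      proof -
        have eq: "(\<Union>i. A i \<inter> J n) = (\<Union>n. A n) \<inter> J n" by blast
        have "(\<lambda>i. pos (A i \<inter> J n)) sums pos (\<Union>i. A i \<inter> J n)"
        proof (rule pos_sums)
          show "range (\<lambda>i. A i \<inter> J n) \<subseteq> borel01"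
            using A(1) J by auto
          show "disjoint_family (\<lambda>i. A i \<inter> J n)"
            using A(2) unfolding disjoint_family_on_def by blast
        qed (simp only: eq fin_J[OF A(3)])
        then show ?thesis
          unfolding eq using A(1) fin_J J by (intro suminf_ennreal_eq pos_nonneg) auto
      qed
      then show ?thesis by (simp add: N_def)
    qed
    finally show "(\<Sum>i. N (A i)) = N (\<Union>n. A n)" .
  qed
  moreover have "positive borel01 N"
    using N_eq[of "{}"] bound[of "{}"] by (simp add: positive_def pos_def)
  ultimately have emeasure_NM: "emeasure NM A = N A" if "A \<in> borel01" for A
    unfolding NM_def using sa that by (intro emeasure_measure_of_sigma)
  have "absolutely_continuous ?m NM"
    unfolding absolutely_continuous_def
  proof
    fix A assume "A \<in> null_sets ?m"
    then have A: "A \<in> borel01" "emeasure ?m A = 0" by auto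
    then have "variation_on \<mu> A = 0" by (simp add: emeasure_variation)
    then have "N A = ennreal (pos A)" "measure ?m A = 0"
      using A by (auto simp: N_eq measure_def)
    moreover have "\<kappa> A = 0"
      using bound[OF A(1)] \<open>variation_on \<mu> A = 0\<close> \<open>measure ?m A = 0\<close> by simp
    ultimately show "A \<in> null_sets NM"
      using A by (auto simp: null_sets_def sets_NM emeasure_NM pos_def)
  qed
  then obtain f where f[measurable]: "f \<in> borel_measurable ?m" and dens: "density ?m f = NM"
    using variation.Radon_Nikodym[of NM] sets_NM by auto
  show ?thesis
  proof (intro bexI[of _ "\<lambda>x. enn2real (f x) - 1"] ballI impI)
    fix A assume A[measurable]: "A \<in> borel01" and fin: "variation_on \<mu> A < \<infinity>"
    have nn: "(\<integral>\<^sup>+x. f x * indicator A x \<partial>?m) = ennreal (pos A)"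
      using emeasure_density[OF f, of A] A fin by (simp add: dens emeasure_NM N_eq)
    \<comment> \<open>The density f is extended-valued. Its integral over A is finite, so it is
      finite almost everywhere there and \<open>enn2real\<close> loses nothing.\<close>
    then have "AE x in ?m. f x * indicator A x \<noteq> \<infinity>"
      by (intro nn_integral_noteq_infinite) auto
    then have ae: "AE x in ?m. ennreal (indicator A x * enn2real (f x)) = f x * indicator A x"
      by eventually_elim (auto simp: indicator_def less_top)
    then have nn': "(\<integral>\<^sup>+x. ennreal (indicator A x * enn2real (f x)) \<partial>?m) = ennreal (pos A)"
      using nn by (simp cong: nn_integral_cong_AE)
    have int: "integrable ?m (\<lambda>x. indicator A x * enn2real (f x))"
      by (rule integrableI_nonneg) (auto simp: nn')
    have eq: "(\<integral>x. indicator A x * enn2real (f x) \<partial>?m) = pos A"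
      using pos_nonneg[OF A fin] by (subst integral_eq_nn_integral) (auto simp: nn')
    have int1: "integrable ?m (\<lambda>x. indicator A x :: real)"
      using fin A by (simp add: integrable_indicator_iff emeasure_variation borel01_subset Int_absorb2)
    have "(LINT x:A|?m. enn2real (f x) - 1) = pos A - measure ?m A"
      unfolding set_lebesgue_integral_def using int int1 eq
      by (simp add: right_diff_distrib borel01_subset Int_absorb2)
    moreover have "set_integrable ?m A (\<lambda>x. enn2real (f x) - 1)"
      unfolding set_integrable_def using int int1 by (simp add: right_diff_distrib)
    ultimately show "set_integrable ?m A (\<lambda>x. enn2real (f x) - 1) \<and>
        \<kappa> A = (LINT x:A|?m. enn2real (f x) - 1)"
      by (simp add: pos_def)
  qed simp
qed

lemma norm_le_measure:
  assumes "A \<in> borel01" "variation_on \<mu> A < \<infinity>"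
  shows "norm (\<mu> A) \<le> measure (variation \<mu>) A"
proof -
  have "ennreal (norm (\<mu> A)) \<le> ennreal (measure (variation \<mu>) A)"
    using norm_le_variation_on[of A \<mu>] assms
    by (simp add: measure_def emeasure_variation less_top)
  then show ?thesis by (simp add: ennreal_le_iff)
qed

text \<open>\<open>polar_density\<close> is a choice, so existence must come first: densities of Re
  \<mu> and Im \<mu> relative to |\<mu>| are combined. Both parts satisfy the required bound, being
  at most |\<mu> A| <= |\<mu>|(A) in modulus.\<close>

lemma polar_density:
  shows borel_measurable_polar_density: "polar_density \<mu> \<in> borel_measurable (variation \<mu>)"
    and polar_density_integral: "A \<in> borel01 \<Longrightarrow> variation_on \<mu> A < \<infinity> \<Longrightarrow>
      set_integrable (variation \<mu>) A (polar_density \<mu>) \<and>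
      \<mu> A = (LINT x:A|variation \<mu>. polar_density \<mu> x)"
proof -
  have "\<exists>f\<in>borel_measurable (variation \<mu>). \<forall>A\<in>borel01. variation_on \<mu> A < \<infinity> \<longrightarrow>
    set_integrable (variation \<mu>) A f \<and> Re (\<mu> A) = (LINT x:A|variation \<mu>. f x)"
    by (intro real_density_exists sums_Re sums_UN) (auto intro: order_trans[OF abs_Re_le_cmod norm_le_measure])
  then obtain f where f: "f \<in> borel_measurable (variation \<mu>)"
    "\<And>A. A \<in> borel01 \<Longrightarrow> variation_on \<mu> A < \<infinity> \<Longrightarrow> set_integrable (variation \<mu>) A f"
    "\<And>A. A \<in> borel01 \<Longrightarrow> variation_on \<mu> A < \<infinity> \<Longrightarrow> Re (\<mu> A) = (LINT x:A|variation \<mu>. f x)"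
    by blast
  have "\<exists>f\<in>borel_measurable (variation \<mu>). \<forall>A\<in>borel01. variation_on \<mu> A < \<infinity> \<longrightarrow>
    set_integrable (variation \<mu>) A f \<and> Im (\<mu> A) = (LINT x:A|variation \<mu>. f x)"
    by (intro real_density_exists sums_Im sums_UN) (auto intro: order_trans[OF abs_Im_le_cmod norm_le_measure])
  then obtain g where g: "g \<in> borel_measurable (variation \<mu>)"
    "\<And>A. A \<in> borel01 \<Longrightarrow> variation_on \<mu> A < \<infinity> \<Longrightarrow> set_integrable (variation \<mu>) A g"
    "\<And>A. A \<in> borel01 \<Longrightarrow> variation_on \<mu> A < \<infinity> \<Longrightarrow> Im (\<mu> A) = (LINT x:A|variation \<mu>. g x)"
    by blast
  define \<phi> where "\<phi> x = complex_of_real (f x) + \<i> * complex_of_real (g x)" for x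
  have "set_integrable (variation \<mu>) A \<phi> \<and> \<mu> A = (LINT x:A|variation \<mu>. \<phi> x)"
    if A: "A \<in> borel01" "variation_on \<mu> A < \<infinity>" for A
  proof
    have i: "set_integrable (variation \<mu>) A (\<lambda>x. complex_of_real (f x))"
      "set_integrable (variation \<mu>) A (\<lambda>x. \<i> * complex_of_real (g x))"
      using f(2)[OF A] g(2)[OF A] by (auto simp: set_integrable_def scaleR_conv_of_real
        simp flip: of_real_mult mult.left_commute[of \<i>])
    then show "set_integrable (variation \<mu>) A \<phi>"
      unfolding \<phi>_def by (rule set_integral_add)
    have "(LINT x:A|variation \<mu>. \<phi> x) = of_real (Re (\<mu> A)) + \<i> * of_real (Im (\<mu> A))"
      unfolding \<phi>_def using i f(3)[OF A] g(3)[OF A]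
      by (simp add: set_integral_add set_integral_complex_of_real)
    then show "\<mu> A = (LINT x:A|variation \<mu>. \<phi> x)"
      by (simp add: complex_eq)
  qed
  moreover have "\<phi> \<in> borel_measurable (variation \<mu>)"
    unfolding \<phi>_def using f(1) g(1) by measurable
  ultimately have "\<exists>\<phi>. \<phi> \<in> borel_measurable (variation \<mu>) \<and> (\<forall>A\<in>borel01. variation_on \<mu> A < \<infinity> \<longrightarrow>
      set_integrable (variation \<mu>) A \<phi> \<and> \<mu> A = (LINT x:A|variation \<mu>. \<phi> x))"
    by blast
  from someI_ex[OF this, folded polar_density_def]
  show "polar_density \<mu> \<in> borel_measurable (variation \<mu>)"
    "A \<in> borel01 \<Longrightarrow> variation_on \<mu> A < \<infinity> \<Longrightarrow>
      set_integrable (variation \<mu>) A (polar_density \<mu>) \<and>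
      \<mu> A = (LINT x:A|variation \<mu>. polar_density \<mu> x)"
    by blast+
qed

text \<open>On the part of {f > 1} inside a compact interval, f - 1 is positive but has integral at
  most 0, so that part is null. The compact interval keeps the variation finite, as the hypotheses
  demand.\<close>

lemma AE_le_1I:
  fixes f :: "real \<Rightarrow> real"
  assumes f[measurable]: "f \<in> borel_measurable (variation \<mu>)"
    and int: "\<And>A. A \<in> borel01 \<Longrightarrow> variation_on \<mu> A < \<infinity> \<Longrightarrow> set_integrable (variation \<mu>) A f"
    and le: "\<And>A. A \<in> borel01 \<Longrightarrow> variation_on \<mu> A < \<infinity> \<Longrightarrow>
      (LINT x:A|variation \<mu>. f x) \<le> measure (variation \<mu>) A"
  shows "AE x in variation \<mu>. f x \<le> 1"
proof -
  let ?m = "variation \<mu>"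
  have "AE x in ?m. x \<in> exhaustion n \<longrightarrow> f x \<le> 1" for n
  proof -
    define A where "A = {x \<in> space ?m. f x > 1} \<inter> exhaustion n"
    have A[measurable]: "A \<in> sets ?m"
    proof -
      have "{x \<in> space ?m. f x > 1} \<in> sets ?m" by measurable
      from sets.Int[OF this] show ?thesis unfolding A_def by simp
    qed
    then have A': "A \<in> borel01" by simp
    have fin: "variation_on \<mu> A < \<infinity>"
      using variation_on_mono[OF A' exhaustion_borel01[of n], of \<mu>] emeasure_exhaustion_finite[of n]
      by (auto simp: A_def emeasure_variation)
    have int1: "integrable ?m (\<lambda>x. indicator A x :: real)"
      using fin A' by (simp add: integrable_indicator_iff emeasure_variation borel01_subset Int_absorb2)
    have i: "integrable ?m (\<lambda>x. indicator A x * f x)"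
      using int[OF A' fin] by (simp add: set_integrable_def)
    have i': "integrable ?m (\<lambda>x. indicator A x * (f x - 1))"
      using i int1 by (simp add: right_diff_distrib)
    have nonneg: "AE x in ?m. 0 \<le> indicator A x * (f x - 1)"
      by (auto simp: indicator_def A_def)
    have "(\<integral>x. indicator A x * (f x - 1) \<partial>?m) = (LINT x:A|?m. f x) - measure ?m A"
      using i int1 borel01_subset[OF A']
      by (simp add: right_diff_distrib set_lebesgue_integral_def Int_absorb2)
    then have "(\<integral>x. indicator A x * (f x - 1) \<partial>?m) = 0"
      using le[OF A' fin] integral_nonneg_AE[OF nonneg] by simp
    then have "AE x in ?m. indicator A x * (f x - 1) = 0"
      using integral_nonneg_eq_0_iff_AE[OF i' nonneg] by simp
    then show ?thesis
      by eventually_elim (use UN_exhaustion in \<open>auto simp: A_def indicator_def split: if_splits\<close>)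
  qed
  then have "AE x in ?m. \<forall>n. x \<in> exhaustion n \<longrightarrow> f x \<le> 1"
    unfolding AE_all_countable by blast
  with AE_space show ?thesis
    by eventually_elim (use UN_exhaustion in auto)
qed

text \<open>For unimodular c, Re (c \<mu>(A)) <= |\<mu>|(A) passes to the density. Four rotations
  bound |Re| and |Im| by 1, hence the modulus by 2. This is the source of the factors 2 in the later
  norm estimates.\<close>

lemma AE_norm_polar_density_le: "AE x in variation \<mu>. norm (polar_density \<mu> x) \<le> 2"
proof -
  let ?m = "variation \<mu>"
  note [measurable] = borel_measurable_polar_density
  have *: "AE x in ?m. Re (c * polar_density \<mu> x) \<le> 1" if c: "norm c = 1" for c
  proof (rule AE_le_1I)
    fix A assume A: "A \<in> borel01" "variation_on \<mu> A < \<infinity>"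
    have i: "integrable ?m (\<lambda>x. indicator A x *\<^sub>R (c * polar_density \<mu> x))"
      using integrable_mult_right[of c ?m "\<lambda>x. indicator A x *\<^sub>R polar_density \<mu> x"] polar_density_integral[OF A]
      by (simp only: set_integrable_def mult_scaleR_right)
    from integrable_Re[OF i] show "set_integrable ?m A (\<lambda>x. Re (c * polar_density \<mu> x))"
      by (simp add: set_integrable_def)
    have "(LINT x:A|?m. Re (c * polar_density \<mu> x)) = Re (c * \<mu> A)"
    proof -
      have "(LINT x:A|?m. Re (c * polar_density \<mu> x)) = Re (LINT x:A|?m. c * polar_density \<mu> x)"
        using integral_Re[OF i] unfolding set_lebesgue_integral_def by simp
      then show ?thesis
        using polar_density_integral[OF A] by simp
    qed
    also have "\<dots> \<le> norm (c * \<mu> A)" by (rule complex_Re_le_cmod)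
    also have "\<dots> \<le> measure ?m A"
      using norm_le_measure[OF A] c by (simp add: norm_mult)
    finally show "(LINT x:A|?m. Re (c * polar_density \<mu> x)) \<le> measure ?m A" .
  qed simp
  have "AE x in ?m. Re (polar_density \<mu> x) \<le> 1" "AE x in ?m. - Re (polar_density \<mu> x) \<le> 1"
    "AE x in ?m. Im (polar_density \<mu> x) \<le> 1" "AE x in ?m. - Im (polar_density \<mu> x) \<le> 1"
    using *[of 1] *[of "-1"] *[of "- \<i>"] *[of \<i>] by simp_all
  then show ?thesis
  proof eventually_elim
    case (elim x)
    then show ?case
      using cmod_le[of "polar_density \<mu> x"] by linarith
  qed
qed

end

section \<open>Integration on the real line\<close>

text \<open>|\<mu>| as a measure on the whole line, null outside [0,1). Translates h(t + s) and
  product measures can then be handled with ordinary Borel sets instead of a restricted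
  sigma-algebra.\<close>

definition mass :: "cmeasure \<Rightarrow> real measure" where
  "mass \<mu> = distr (variation \<mu>) borel (\<lambda>x. x)"

text \<open>A version of the polar density bounded by 2 at every point and zero off [0,1), so that
  dominations hold pointwise. For locally finite \<mu> it differs from \<open>polar_density\<close>
  on [0,1) only on a |\<mu>|-null set.\<close>

definition dens :: "cmeasure \<Rightarrow> real \<Rightarrow> complex" where
  "dens \<mu> x = (if x \<in> {0..<1} \<and> norm (polar_density \<mu> x) \<le> 2 then polar_density \<mu> x else 0)"

lemma cint_cong:
  assumes "\<And>x. x \<in> S \<Longrightarrow> x \<in> {0..<1} \<Longrightarrow> h x = h' x" "\<mu> \<in> locally_finite_measures"
  shows "cint \<mu> S h = cint \<mu> S h'"
proof -
  interpret lfin_measure \<mu> by unfold_locales fact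
  show ?thesis
    unfolding cint_def set_lebesgue_integral_def
    by (intro Bochner_Integration.integral_cong refl) (use assms(1) in \<open>auto simp: indicator_def\<close>)
qed

lemma sets_mass [simp, measurable_cong]: "sets (mass \<mu>) = sets borel"
  and space_mass [simp]: "space (mass \<mu>) = UNIV"
  by (simp_all add: mass_def)

lemma measurable_mass [simp]: "measurable (mass \<mu>) N = measurable borel N"
  by (rule measurable_cong_sets) simp_all

lemma dens_eq_0: "x \<notin> {0..<1} \<Longrightarrow> dens \<mu> x = 0"
  by (auto simp: dens_def)

lemma norm_dens_le: "norm (dens \<mu> x) \<le> 2"
  by (simp add: dens_def)

context lfin_measure
begin

lemma borel_measurable_dens [measurable]: "dens \<mu> \<in> borel_measurable borel"
proof -
  have "polar_density \<mu> \<in> borel_measurable (restrict_space borel {0..<1})"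
    using borel_measurable_polar_density by simp
  then have [measurable]: "(\<lambda>x. if x \<in> {0..<1} then polar_density \<mu> x else 0) \<in> borel_measurable borel"
    by (subst (asm) measurable_restrict_space_iff[where c = 0]) auto
  have "dens \<mu> = (\<lambda>x. if norm (if x \<in> {0..<1} then polar_density \<mu> x else 0) \<le> 2
      then (if x \<in> {0..<1} then polar_density \<mu> x else 0) else 0)"
    by (auto simp: dens_def fun_eq_iff)
  also have "\<dots> \<in> borel_measurable borel"
    by measurable
  finally show ?thesis .
qed

lemma measurable_id_variation [measurable]: "(\<lambda>x. x) \<in> measurable (variation \<mu>) borel"
proof -
  have "(\<lambda>x. x) \<in> measurable (restrict_space borel {0..<1::real}) borel"
    by (rule measurable_restrict_space1) simp
  then show ?thesis
    by (simp cong: measurable_cong_sets)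
qed

lemma emeasure_mass:
  assumes "A \<in> sets borel"
  shows "emeasure (mass \<mu>) A = variation_on \<mu> (A \<inter> {0..<1})"
  unfolding mass_def using assms
  by (subst emeasure_distr) (auto simp: emeasure_variation borel01_iff)

lemma measure_mass: "A \<in> sets borel \<Longrightarrow> measure (mass \<mu>) A = measure (variation \<mu>) (A \<inter> {0..<1})"
  by (simp add: measure_def emeasure_mass emeasure_variation borel01_iff)

lemma emeasure_mass_finite:
  assumes "A \<in> sets borel" "A \<subseteq> {..a}" "a < 1"
  shows "emeasure (mass \<mu>) A < \<infinity>"
proof -
  have "emeasure (mass \<mu>) A \<le> variation_on \<mu> {0..a}"
    unfolding emeasure_mass[OF assms(1)] using assms
    by (intro variation_on_mono) (auto simp: borel01_iff)
  then show ?thesis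
    using variation_on_compact_finite[OF assms(3)] by (rule le_less_trans)
qed

text \<open>Sigma-finiteness is what parameter integrals and Fubini's theorem rest on. The covering
  sets are the compact intervals and the null complement of [0,1).\<close>

sublocale mass: sigma_finite_measure "mass \<mu>"
proof
  have "emeasure (mass \<mu>) (exhaustion n) \<noteq> \<infinity>" for n
    using emeasure_mass_finite[of "exhaustion n" "1 - 1 / real (Suc n)"] exhaustion_borel01[of n]
    by (auto simp: borel01_iff exhaustion_def simp del: of_nat_Suc)
  moreover have "emeasure (mass \<mu>) (- {0..<1}) \<noteq> \<infinity>"
    by (subst emeasure_mass) simp_all
  ultimately show "\<exists>A. countable A \<and> A \<subseteq> sets (mass \<mu>) \<and> \<Union>A = space (mass \<mu>) \<and>
      (\<forall>a\<in>A. emeasure (mass \<mu>) a \<noteq> \<infinity>)"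
    using UN_exhaustion exhaustion_borel01
    by (intro exI[of _ "insert (- {0..<1}) (range exhaustion)"]) (auto simp: borel01_iff)
qed

lemma cint_eq:
  assumes [measurable]: "S \<in> sets borel" "h \<in> borel_measurable borel"
  shows "cint \<mu> S h = (\<integral>x. indicator S x *\<^sub>R (h x * dens \<mu> x) \<partial>mass \<mu>)"
proof -
  note [measurable] = borel_measurable_polar_density
  have S[measurable]: "Measurable.pred (variation \<mu>) (\<lambda>x. x \<in> S)" "h \<in> borel_measurable (variation \<mu>)"
    "dens \<mu> \<in> borel_measurable (variation \<mu>)"
    using measurable_compose[OF measurable_id_variation, of "\<lambda>x. x \<in> S" "count_space UNIV"]
      measurable_compose[OF measurable_id_variation, of h borel]
      measurable_compose[OF measurable_id_variation, of "dens \<mu>" borel] by simp_all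
  have "(\<integral>x. indicator S x *\<^sub>R (h x * dens \<mu> x) \<partial>mass \<mu>) =
      (\<integral>x. indicator S x *\<^sub>R (h x * dens \<mu> x) \<partial>variation \<mu>)"
    unfolding mass_def by (rule integral_distr) measurable
  also have "\<dots> = cint \<mu> S h"
    unfolding cint_def set_lebesgue_integral_def
  proof (rule integral_cong_AE)
    show "AE x in variation \<mu>. indicator S x *\<^sub>R (h x * dens \<mu> x) =
        indicator S x *\<^sub>R (h x * polar_density \<mu> x)"
      using AE_norm_polar_density_le AE_space
      by eventually_elim (auto simp: dens_def)
  qed measurable
  finally show ?thesis ..
qed

lemma integrable_dens:
  assumes [measurable]: "S \<in> sets borel" "h \<in> borel_measurable borel"
    and fin: "emeasure (mass \<mu>) S < \<infinity>" and B: "\<And>x. x \<in> S \<Longrightarrow> norm (h x) \<le> B"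
  shows "integrable (mass \<mu>) (\<lambda>x. indicator S x *\<^sub>R (h x * dens \<mu> x))"
    and "norm (\<integral>x. indicator S x *\<^sub>R (h x * dens \<mu> x) \<partial>mass \<mu>) \<le> 2 * B * measure (mass \<mu>) S"
proof -
  have le: "norm (indicator S x *\<^sub>R (h x * dens \<mu> x)) \<le> 2 * B * indicator S x" for x
    using mult_mono[OF B[of x] norm_dens_le[of \<mu> x]] order_trans[OF norm_ge_zero B[of x]]
    by (auto simp: indicator_def norm_mult mult.commute)
  have int: "integrable (mass \<mu>) (\<lambda>x. 2 * B * indicator S x :: real)"
    using fin by (simp add: integrable_indicator_iff)
  show "integrable (mass \<mu>) (\<lambda>x. indicator S x *\<^sub>R (h x * dens \<mu> x))"
  proof (rule Bochner_Integration.integrable_bound[OF int])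
    show "AE x in mass \<mu>. norm (indicator S x *\<^sub>R (h x * dens \<mu> x)) \<le> norm (2 * B * indicator S x :: real)"
      by (rule AE_I2, rule order_trans[OF le]) simp
    have "(\<lambda>x. indicator S x *\<^sub>R (h x * dens \<mu> x)) \<in> borel_measurable borel"
      by measurable
    then show "(\<lambda>x. indicator S x *\<^sub>R (h x * dens \<mu> x)) \<in> borel_measurable (mass \<mu>)"
      by simp
  qed
  show "norm (\<integral>x. indicator S x *\<^sub>R (h x * dens \<mu> x) \<partial>mass \<mu>) \<le> 2 * B * measure (mass \<mu>) S"
    using Bochner_Integration.integral_norm_bound_integral[OF \<open>integrable (mass \<mu>) (\<lambda>x. indicator S x *\<^sub>R (h x * dens \<mu> x))\<close> int le]
    by simp
qed

lemma integral_indicator_dens: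
  assumes "A \<in> borel01" "variation_on \<mu> A < \<infinity>"
  shows "(\<integral>x. indicator A x * dens \<mu> x \<partial>mass \<mu>) = \<mu> A"
proof -
  have A: "A \<in> sets borel" using assms by (simp add: borel01_iff)
  have "(\<integral>x. indicator A x * dens \<mu> x \<partial>mass \<mu>) = cint \<mu> A (\<lambda>_. 1)"
    using A by (auto simp: cint_eq indicator_def intro!: Bochner_Integration.integral_cong)
  also have "\<dots> = \<mu> A"
    using polar_density_integral[OF assms] by (simp add: cint_def)
  finally show ?thesis .
qed

end

section \<open>Complex measures as functionals on bounded Borel functions\<close>

definition bounded_borel :: "(real \<Rightarrow> complex) set" where
  "bounded_borel = {h \<in> borel_measurable borel. \<exists>B. \<forall>x. norm (h x) \<le> B}"

lemma bounded_borelI: "h \<in> borel_measurable borel \<Longrightarrow> (\<And>x. norm (h x) \<le> B) \<Longrightarrow> h \<in> bounded_borel"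
  by (auto simp: bounded_borel_def)

lemma bounded_borelE:
  assumes "h \<in> bounded_borel"
  obtains B where "h \<in> borel_measurable borel" "\<And>x. norm (h x) \<le> B"
  using assms by (auto simp: bounded_borel_def)

lemma bounded_borel_measurable [measurable_dest]: "h \<in> bounded_borel \<Longrightarrow> h \<in> borel_measurable borel"
  by (simp add: bounded_borel_def)

lemma bounded_borel_mult:
  assumes "f \<in> bounded_borel" "g \<in> bounded_borel"
  shows "(\<lambda>x. f x * g x) \<in> bounded_borel"
proof -
  obtain B where B: "f \<in> borel_measurable borel" "\<And>x. norm (f x) \<le> B"
    using assms(1) by (rule bounded_borelE) blast
  obtain C where C: "g \<in> borel_measurable borel" "\<And>x. norm (g x) \<le> C"
    using assms(2) by (rule bounded_borelE) blast
  show ?thesis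
  proof (rule bounded_borelI)
    show "norm (f x * g x) \<le> B * C" for x
      unfolding norm_mult using B(2) C(2) order_trans[OF norm_ge_zero B(2)] by (intro mult_mono) auto
  qed (use B(1) C(1) in measurable)
qed

lemma bounded_borel_add:
  assumes "f \<in> bounded_borel" "g \<in> bounded_borel"
  shows "(\<lambda>x. f x + g x) \<in> bounded_borel"
proof -
  obtain B where B: "f \<in> borel_measurable borel" "\<And>x. norm (f x) \<le> B"
    using assms(1) by (rule bounded_borelE) blast
  obtain C where C: "g \<in> borel_measurable borel" "\<And>x. norm (g x) \<le> C"
    using assms(2) by (rule bounded_borelE) blast
  show ?thesis
  proof (rule bounded_borelI)
    show "norm (f x + g x) \<le> B + C" for x
      by (rule norm_triangle_le) (intro add_mono B C)
  qed (use B(1) C(1) in measurable)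
qed

lemma bounded_borel_const [simp]: "(\<lambda>_. c) \<in> bounded_borel"
  by (rule bounded_borelI[of _ "norm c"]) auto

lemma bounded_borel_indicator [simp]: "A \<in> sets borel \<Longrightarrow> indicator A \<in> bounded_borel"
  by (rule bounded_borelI[of _ 1]) (auto simp: indicator_def)

lemma bounded_borel_sum:
  assumes "finite I" "\<And>i. i \<in> I \<Longrightarrow> f i \<in> bounded_borel"
  shows "(\<lambda>x. \<Sum>i\<in>I. f i x) \<in> bounded_borel"
  using assms by (induction I rule: finite_induct) (auto intro: bounded_borel_add)

text \<open>The functional side of a finite measure on [0,1): \<open>lim\<close> stands for
  countable additivity, \<open>local\<close> says that the functional lives on [0,1), and C is a
  bound for the norm, not necessarily the norm itself.\<close>

locale measure_functional =
  fixes L :: "(real \<Rightarrow> complex) \<Rightarrow> complex" and C :: real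
  assumes add: "\<And>f g. f \<in> bounded_borel \<Longrightarrow> g \<in> bounded_borel \<Longrightarrow> L (\<lambda>x. f x + g x) = L f + L g"
    and scale: "\<And>c f. f \<in> bounded_borel \<Longrightarrow> L (\<lambda>x. c * f x) = c * L f"
    and lim: "\<And>F f B. (\<And>n::nat. F n \<in> borel_measurable borel) \<Longrightarrow> (\<And>n x. norm (F n x) \<le> B) \<Longrightarrow>
      (\<And>x. (\<lambda>n. F n x) \<longlonglongrightarrow> f x) \<Longrightarrow> (\<lambda>n. L (F n)) \<longlonglongrightarrow> L f"
    and norm_le: "\<And>h B. h \<in> borel_measurable borel \<Longrightarrow> (\<And>x. norm (h x) \<le> B) \<Longrightarrow> norm (L h) \<le> C * B"
    and local: "\<And>h. h \<in> bounded_borel \<Longrightarrow> L (\<lambda>x. indicator {0..<1} x * h x) = L h"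
begin

lemma zero: "L (\<lambda>_. 0) = 0"
  using scale[of "\<lambda>_. 0" 0] by simp

lemma sum:
  assumes "finite I" "\<And>i. i \<in> I \<Longrightarrow> f i \<in> bounded_borel"
  shows "L (\<lambda>x. \<Sum>i\<in>I. f i x) = (\<Sum>i\<in>I. L (f i))"
  using assms by (induction I rule: finite_induct) (auto simp: zero add bounded_borel_sum)

lemma C_nonneg: "0 \<le> C"
  using order_trans[OF norm_ge_zero norm_le[of "\<lambda>_. 0" 1]] by simp

end

definition measure_of_functional :: "((real \<Rightarrow> complex) \<Rightarrow> complex) \<Rightarrow> cmeasure" where
  "measure_of_functional L A = (if A \<in> borel01 then L (indicator A) else 0)"

text \<open>Agreement passes from indicators to simple functions by linearity and on to bounded
  Borel functions by bounded pointwise limits; \<open>local\<close> reduces indicators of arbitrary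
  Borel sets to those inside [0,1).\<close>

lemma measure_functional_eqI:
  assumes "measure_functional L C" "measure_functional K C'"
    and eq: "\<And>A. A \<in> borel01 \<Longrightarrow> L (indicator A) = K (indicator A)"
    and h: "h \<in> bounded_borel"
  shows "L h = K h"
proof -
  interpret L: measure_functional L C by fact
  interpret K: measure_functional K C' by fact
  have eq': "L (indicator A) = K (indicator A)" if A: "A \<in> sets borel" for A
  proof -
    have "(\<lambda>x. indicator {0..<1} x * indicator A x) = (indicator (A \<inter> {0..<1}) :: real \<Rightarrow> complex)"
      by (auto simp: indicator_def)
    then show ?thesis
      using L.local[of "indicator A"] K.local[of "indicator A"] eq[of "A \<inter> {0..<1}"] A
      by (simp add: borel01_iff)
  qed
  obtain B where B: "h \<in> borel_measurable borel" "\<And>x. norm (h x) \<le> B"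
    using h by (rule bounded_borelE) blast
  \<comment> \<open>Approximation around the point 0 gives simple functions of norm at most 2 |h|,
    so \<open>2 * B\<close> is a common bound for the sequence.\<close>
  obtain F where F: "\<And>i. simple_function borel (F i)" "\<And>x. (\<lambda>i. F i x) \<longlonglongrightarrow> h x"
    "\<And>i x. norm (F i x) \<le> 2 * norm (h x)"
    using borel_measurable_implies_sequence_metric[OF B(1), of 0] by (auto simp: dist_norm)
  have "L (F i) = K (F i)" for i
  proof -
    have meas: "F i -` {y} \<in> sets borel" if "y \<in> range (F i)" for y
      using F(1)[of i] that by (auto simp: simple_function_def)
    have "finite (range (F i))"
      using F(1)[of i] by (auto simp: simple_function_def)
    have rep: "F i = (\<lambda>x. \<Sum>y\<in>range (F i). y * indicator (F i -` {y}) x)"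
    proof
      fix x
      have "(\<Sum>y\<in>range (F i). y * indicator (F i -` {y}) x) = (\<Sum>y\<in>range (F i). if y = F i x then y else 0)"
        by (intro sum.cong) (auto simp: indicator_def)
      then show "F i x = (\<Sum>y\<in>range (F i). y * indicator (F i -` {y}) x)"
        using \<open>finite (range (F i))\<close> by simp
    qed
    have lin: "M (F i) = (\<Sum>y\<in>range (F i). y * M (indicator (F i -` {y})))"
      if "measure_functional M c" for M c
    proof -
      interpret M: measure_functional M c by fact
      have "M (F i) = (\<Sum>y\<in>range (F i). M (\<lambda>x. y * indicator (F i -` {y}) x))"
        by (subst rep, rule M.sum) (auto intro!: bounded_borel_mult bounded_borel_indicator meas[OF rangeI] \<open>finite (range (F i))\<close>)
      also have "\<dots> = (\<Sum>y\<in>range (F i). y * M (indicator (F i -` {y})))"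
        by (intro sum.cong refl M.scale bounded_borel_indicator meas)
      finally show ?thesis .
    qed
    have "L (F i) = (\<Sum>y\<in>range (F i). y * L (indicator (F i -` {y})))"
      by (rule lin) fact
    also have "\<dots> = (\<Sum>y\<in>range (F i). y * K (indicator (F i -` {y})))"
      by (intro sum.cong refl) (simp add: eq' meas)
    also have "\<dots> = K (F i)"
      by (rule lin[symmetric]) fact
    finally show ?thesis .
  qed
  moreover have "norm (F i x) \<le> 2 * B" for i x
    using F(3)[of i x] B(2)[of x] by linarith
  then have "(\<lambda>i. L (F i)) \<longlonglongrightarrow> L h" "(\<lambda>i. K (F i)) \<longlonglongrightarrow> K h"
    using F(1,2) by (auto intro!: L.lim[of F "2 * B"] K.lim[of F "2 * B"] borel_measurable_simple_function)
  ultimately show ?thesis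
    using LIMSEQ_unique by auto
qed

text \<open>Composition with an operator \<Phi> that is linear, bounded and continuous under bounded
  pointwise limits. Convolution of finite measures, multiplication by the coordinate and the
  derivation are all built this way, each from its own transpose \<Phi>.\<close>

lemma measure_functional_compose:
  assumes "measure_functional K C" and c: "0 \<le> c"
    and meas: "\<And>h. h \<in> bounded_borel \<Longrightarrow> \<Phi> h \<in> borel_measurable borel"
    and bound: "\<And>h B x. h \<in> borel_measurable borel \<Longrightarrow> (\<And>x. norm (h x) \<le> B) \<Longrightarrow> norm (\<Phi> h x) \<le> c * B"
    and add: "\<And>f g x. f \<in> bounded_borel \<Longrightarrow> g \<in> bounded_borel \<Longrightarrow> \<Phi> (\<lambda>x. f x + g x) x = \<Phi> f x + \<Phi> g x"
    and scale: "\<And>c f x. f \<in> bounded_borel \<Longrightarrow> \<Phi> (\<lambda>x. c * f x) x = c * \<Phi> f x"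
    and lim: "\<And>F f B x. (\<And>n::nat. F n \<in> borel_measurable borel) \<Longrightarrow> (\<And>n x. norm (F n x) \<le> B) \<Longrightarrow>
      (\<And>x. (\<lambda>n. F n x) \<longlonglongrightarrow> f x) \<Longrightarrow> (\<lambda>n. \<Phi> (F n) x) \<longlonglongrightarrow> \<Phi> f x"
    and local: "\<And>h x. h \<in> bounded_borel \<Longrightarrow> \<Phi> (\<lambda>x. indicator {0..<1} x * h x) x = \<Phi> h x"
  shows "measure_functional (\<lambda>h. K (\<Phi> h)) (C * c)"
proof -
  interpret K: measure_functional K C by fact
  have bb: "\<Phi> h \<in> bounded_borel" if "h \<in> bounded_borel" for h
  proof -
    obtain B where "h \<in> borel_measurable borel" "\<And>x. norm (h x) \<le> B"
      using \<open>h \<in> bounded_borel\<close> by (rule bounded_borelE) blast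
    from bounded_borelI[OF meas[OF that] bound[OF this]] show ?thesis .
  qed
  show ?thesis
  proof
    fix f g c assume "f \<in> bounded_borel" "g \<in> bounded_borel"
    then have "\<Phi> (\<lambda>x. f x + g x) = (\<lambda>x. \<Phi> f x + \<Phi> g x)"
      by (intro ext add)
    then show "K (\<Phi> (\<lambda>x. f x + g x)) = K (\<Phi> f) + K (\<Phi> g)"
      using \<open>f \<in> bounded_borel\<close> \<open>g \<in> bounded_borel\<close> by (simp add: K.add bb)
  next
    fix f c assume "f \<in> bounded_borel"
    then have "\<Phi> (\<lambda>x. c * f x) = (\<lambda>x. c * \<Phi> f x)"
      by (intro ext scale)
    then show "K (\<Phi> (\<lambda>x. c * f x)) = c * K (\<Phi> f)"
      using \<open>f \<in> bounded_borel\<close> by (simp add: K.scale bb)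
  next
    fix f assume "f \<in> bounded_borel"
    then have "\<Phi> (\<lambda>x. indicator {0..<1} x * f x) = \<Phi> f"
      by (intro ext local)
    then show "K (\<Phi> (\<lambda>x. indicator {0..<1} x * f x)) = K (\<Phi> f)" by simp
  next
    fix h :: "real \<Rightarrow> complex" and B assume h: "h \<in> borel_measurable borel" "\<And>x. norm (h x) \<le> B"
    then have "norm (K (\<Phi> h)) \<le> C * (c * B)"
      by (intro K.norm_le meas bound bounded_borelI)
    then show "norm (K (\<Phi> h)) \<le> C * c * B" by (simp add: mult.assoc)
  next
    fix F :: "nat \<Rightarrow> real \<Rightarrow> complex" and f B
    assume F: "\<And>n. F n \<in> borel_measurable borel" "\<And>n x. norm (F n x) \<le> B" "\<And>x. (\<lambda>n. F n x) \<longlonglongrightarrow> f x"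
    show "(\<lambda>n. K (\<Phi> (F n))) \<longlonglongrightarrow> K (\<Phi> f)"
      using F by (intro K.lim[of "\<lambda>n. \<Phi> (F n)" "c * B"] meas bound lim bounded_borelI)
  qed
qed

lemma measure_functional_add:
  assumes "measure_functional K C" "measure_functional L C'"
  shows "measure_functional (\<lambda>h. K h + L h) (C + C')"
proof -
  interpret K: measure_functional K C by fact
  interpret L: measure_functional L C' by fact
  show ?thesis
  proof
    fix h :: "real \<Rightarrow> complex" and B assume h: "h \<in> borel_measurable borel" "\<And>x. norm (h x) \<le> B"
    show "norm (K h + L h) \<le> (C + C') * B"
      using norm_triangle_mono[OF K.norm_le[OF h] L.norm_le[OF h]] by (simp add: distrib_right)
  next
    fix F :: "nat \<Rightarrow> real \<Rightarrow> complex" and f B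
    assume F: "\<And>n. F n \<in> borel_measurable borel" "\<And>n x. norm (F n x) \<le> B" "\<And>x. (\<lambda>n. F n x) \<longlonglongrightarrow> f x"
    show "(\<lambda>n. K (F n) + L (F n)) \<longlonglongrightarrow> K f + L f"
      by (rule tendsto_add[OF K.lim[OF F] L.lim[OF F]])
  qed (simp_all add: K.add L.add K.scale L.scale K.local L.local distrib_left)
qed

text \<open>Bounded pointwise limits pass through the integral by dominated convergence, with
  dominating function B |g|. The instances are integration against a finite measure and against an
  integrable function.\<close>

lemma measure_functional_integral:
  assumes g: "integrable M g" and T[measurable]: "T \<in> borel_measurable M"
    and supp: "\<And>x. x \<in> space M \<Longrightarrow> T x \<notin> {0..<1} \<Longrightarrow> g x = 0"
  shows "measure_functional (\<lambda>h. \<integral>x. h (T x) * g x \<partial>M) (\<integral>x. norm (g x) \<partial>M)"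
proof -
  note [measurable] = borel_measurable_integrable[OF g]
  have le: "norm (h (T x) * g x) \<le> B * norm (g x)" if "\<And>x. norm (h x) \<le> B" for h :: "real \<Rightarrow> complex" and B x
    unfolding norm_mult using that by (intro mult_right_mono) auto
  have gB: "integrable M (\<lambda>x. B * norm (g x))" for B
    using g by simp
  have int: "integrable M (\<lambda>x. h (T x) * g x)" if "h \<in> bounded_borel" for h
  proof -
    obtain B where B: "h \<in> borel_measurable borel" "\<And>x. norm (h x) \<le> B"
      using \<open>h \<in> bounded_borel\<close> by (rule bounded_borelE) blast
    note [measurable] = B(1)
    show ?thesis
    proof (rule Bochner_Integration.integrable_bound[OF gB[of B]])
      show "AE x in M. norm (h (T x) * g x) \<le> norm (B * norm (g x))"
        by (rule AE_I2, rule order_trans[OF le[OF B(2)]]) simp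
    qed measurable
  qed
  show ?thesis
  proof
    fix f h c assume "f \<in> bounded_borel" "h \<in> bounded_borel"
    then show "(\<integral>x. (f (T x) + h (T x)) * g x \<partial>M) = (\<integral>x. f (T x) * g x \<partial>M) + (\<integral>x. h (T x) * g x \<partial>M)"
      using int by (simp add: ring_distribs)
  next
    fix f c assume "f \<in> bounded_borel"
    then show "(\<integral>x. c * f (T x) * g x \<partial>M) = c * (\<integral>x. f (T x) * g x \<partial>M)"
      by (simp add: mult.assoc)
  next
    fix f assume "f \<in> bounded_borel"
    then show "(\<integral>x. indicator {0..<1} (T x) * f (T x) * g x \<partial>M) = (\<integral>x. f (T x) * g x \<partial>M)"
      using supp by (intro Bochner_Integration.integral_cong) (auto simp: indicator_def)
  next
    fix h :: "real \<Rightarrow> complex" and B assume h: "h \<in> borel_measurable borel" "\<And>x. norm (h x) \<le> B"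
    have "norm (\<integral>x. h (T x) * g x \<partial>M) \<le> (\<integral>x. B * norm (g x) \<partial>M)"
      by (intro order_trans[OF integral_norm_bound] integral_mono integrable_norm int bounded_borelI[OF h] gB le h(2))
    then show "norm (\<integral>x. h (T x) * g x \<partial>M) \<le> (\<integral>x. norm (g x) \<partial>M) * B"
      by (simp add: mult.commute)
  next
    fix F :: "nat \<Rightarrow> real \<Rightarrow> complex" and f B
    assume F: "\<And>n. F n \<in> borel_measurable borel" "\<And>n x. norm (F n x) \<le> B" "\<And>x. (\<lambda>n. F n x) \<longlonglongrightarrow> f x"
    note [measurable] = F(1)
    have [measurable]: "f \<in> borel_measurable borel"
      using F(1,3) by (rule borel_measurable_LIMSEQ_metric)
    show "(\<lambda>n. \<integral>x. F n (T x) * g x \<partial>M) \<longlonglongrightarrow> (\<integral>x. f (T x) * g x \<partial>M)"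
      by (rule integral_dominated_convergence[where w = "\<lambda>x. B * norm (g x)"])
        (auto simp: integrable_norm[OF g] intro!: le F tendsto_intros)
  qed
qed

locale fin_measure =
  fixes \<nu> :: cmeasure
  assumes finite_measures: "\<nu> \<in> finite_measures"
begin

sublocale lfin_measure \<nu>
  using finite_measures by unfold_locales (simp add: finite_measures_def)

sublocale mass: finite_measure "mass \<nu>"
proof
  show "emeasure (mass \<nu>) (space (mass \<nu>)) \<noteq> \<infinity>"
    using finite_measures by (auto simp: emeasure_mass finite_measures_def less_top)
qed

lemma mnorm_eq: "mnorm \<nu> = measure (mass \<nu>) UNIV"
  by (simp add: mnorm_def measure_mass)

lemma integrable_dens_finite: "integrable (mass \<nu>) (dens \<nu>)"
  by (rule mass.integrable_const_bound[of _ 2]) (auto intro: norm_dens_le)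

lemma cint_eq_integral:
  assumes "h \<in> borel_measurable borel"
  shows "cint \<nu> {0..<1} h = (\<integral>x. h x * dens \<nu> x \<partial>mass \<nu>)"
  using assms by (auto simp: cint_eq indicator_def dens_eq_0 intro!: Bochner_Integration.integral_cong)

lemma variation_finite: "A \<in> borel01 \<Longrightarrow> variation_on \<nu> A < \<infinity>"
  using variation_on_mono[of A "{0..<1}" \<nu>] finite_measures
  by (auto simp: finite_measures_def borel01_iff intro: le_less_trans)

lemma cint_indicator: "A \<in> borel01 \<Longrightarrow> cint \<nu> {0..<1} (indicator A) = \<nu> A"
  using integral_indicator_dens[OF _ variation_finite, of A]
  by (subst cint_eq_integral) (auto simp: borel01_iff)

text \<open>The pointwise bound on \<open>dens \<nu>\<close> makes its absolute integral at most
  twice the mass of |\<nu>|, whence the constant.\<close>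

lemma measure_functional_cint: "measure_functional (\<lambda>h. cint \<nu> {0..<1} h) (2 * mnorm \<nu>)"
proof -
  interpret L: measure_functional "\<lambda>h. \<integral>x. h x * dens \<nu> x \<partial>mass \<nu>" "\<integral>x. norm (dens \<nu> x) \<partial>mass \<nu>"
    by (rule measure_functional_integral) (auto simp: integrable_dens_finite dens_eq_0)
  have C: "(\<integral>x. norm (dens \<nu> x) \<partial>mass \<nu>) \<le> 2 * mnorm \<nu>"
    using integral_mono[of "mass \<nu>" "\<lambda>x. norm (dens \<nu> x)" "\<lambda>_. 2"] integrable_dens_finite norm_dens_le
    by (simp add: mnorm_eq mult.commute)
  have eq: "cint \<nu> {0..<1} h = (\<integral>x. h x * dens \<nu> x \<partial>mass \<nu>)" if "h \<in> bounded_borel" for h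
    using that by (intro cint_eq_integral bounded_borel_measurable)
  show ?thesis
  proof
    fix F :: "nat \<Rightarrow> real \<Rightarrow> complex" and f B
    assume F: "\<And>n. F n \<in> borel_measurable borel" "\<And>n x. norm (F n x) \<le> B" "\<And>x. (\<lambda>n. F n x) \<longlonglongrightarrow> f x"
    have "f \<in> borel_measurable borel"
      using F(1,3) by (rule borel_measurable_LIMSEQ_metric)
    then show "(\<lambda>n. cint \<nu> {0..<1} (F n)) \<longlonglongrightarrow> cint \<nu> {0..<1} f"
      using L.lim[OF F] F(1) by (simp add: cint_eq_integral)
  next
    fix h :: "real \<Rightarrow> complex" and B assume h: "h \<in> borel_measurable borel" "\<And>x. norm (h x) \<le> B"
    have "0 \<le> B" using order_trans[OF norm_ge_zero h(2)] .
    then have "(\<integral>x. norm (dens \<nu> x) \<partial>mass \<nu>) * B \<le> 2 * mnorm \<nu> * B"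
      using C by (intro mult_right_mono)
    then show "norm (cint \<nu> {0..<1} h) \<le> 2 * mnorm \<nu> * B"
      using L.norm_le[OF h] h(1) by (simp add: cint_eq_integral)
  qed (simp_all add: eq L.add L.scale L.local bounded_borel_add bounded_borel_mult)
qed

end

section \<open>From a functional back to a finite measure\<close>

lemma sum_indicator_partition_norm_le:
  fixes c :: "real set \<Rightarrow> complex"
  assumes "finite P" "disjoint P" "\<And>B. B \<in> P \<Longrightarrow> norm (c B) \<le> 1"
  shows "norm (\<Sum>B\<in>P. c B * indicator B x) \<le> 1"
proof (cases "\<exists>B\<in>P. x \<in> B")
  case True
  then obtain B where B: "B \<in> P" "x \<in> B" by blast
  have "(\<Sum>D\<in>P. c D * indicator D x) = (\<Sum>D\<in>P. if D = B then c D else 0)"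
    using B assms(2) by (intro sum.cong) (auto simp: indicator_def disjoint_def)
  then show ?thesis
    using assms B by simp
next
  case False
  then have "(\<Sum>D\<in>P. c D * indicator D x) = 0"
    by (intro sum.neutral) (auto simp: indicator_def)
  then show ?thesis by simp
qed

context measure_functional
begin

text \<open>Duality: L is evaluated at a step function whose coefficients turn every term into
  |L(1_B)|. The blocks are disjoint, so the step function has sup norm at most 1.\<close>

lemma variation_on_le: "variation_on (measure_of_functional L) A \<le> ennreal C"
proof (rule variation_on_leI)
  fix P assume P: "finite P" "partition_on A P" "P \<subseteq> borel01"
  \<comment> \<open>Since \<open>sgn 0 = 0\<close>, a block with value 0 receives coefficient 0; all
    coefficients have modulus at most 1.\<close>
  define c where "c B = cnj (sgn (L (indicator B)))" for B :: "real set"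
  have c: "c B * L (indicator B) = of_real (norm (L (indicator B)))" for B
    using complex_norm_square[of "L (indicator B)"]
    by (cases "L (indicator B) = 0") (simp_all add: c_def sgn_eq power2_eq_square field_simps)
  have bb: "indicator B \<in> bounded_borel" if "B \<in> P" for B
    using that P by (auto simp: borel01_iff)
  have "complex_of_real (\<Sum>B\<in>P. norm (L (indicator B))) = L (\<lambda>x. \<Sum>B\<in>P. c B * indicator B x)"
    using P(1) bb by (subst sum) (auto simp: c scale intro!: bounded_borel_mult)
  then have "norm (complex_of_real (\<Sum>B\<in>P. norm (L (indicator B)))) \<le> C * 1"
  proof (simp only:, intro norm_le)
    show "norm (\<Sum>B\<in>P. c B * indicator B x) \<le> 1" for x
      using P by (intro sum_indicator_partition_norm_le) (auto simp: partition_on_def c_def norm_sgn)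
    show "(\<lambda>x. \<Sum>B\<in>P. c B * indicator B x) \<in> borel_measurable borel"
      using P bb by (intro bounded_borel_measurable bounded_borel_sum bounded_borel_mult) auto
  qed
  then have "(\<Sum>B\<in>P. norm (L (indicator B))) \<le> C"
    unfolding norm_of_real by linarith
  then have "ennreal (\<Sum>B\<in>P. norm (L (indicator B))) \<le> ennreal C"
    by (rule ennreal_leI)
  also have "ennreal (\<Sum>B\<in>P. norm (L (indicator B))) = (\<Sum>B\<in>P. ennreal (norm (measure_of_functional L B)))"
    using P by (subst sum_ennreal) (auto simp: measure_of_functional_def subset_iff intro!: arg_cong[of _ _ ennreal] sum.cong)
  finally show "(\<Sum>B\<in>P. ennreal (norm (measure_of_functional L B))) \<le> ennreal C" .
qed

text \<open>Countable additivity is \<open>lim\<close> applied to the indicators of the finite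
  unions. Every variation is at most C, so only non-Borel sets fall under the zero
  convention.\<close>

lemma measure_of_functional_finite: "measure_of_functional L \<in> finite_measures"
proof -
  have fin: "variation_on (measure_of_functional L) A < \<infinity>" for A
    using variation_on_le[of A] by (simp add: le_less_trans)
  then have ne: "variation_on (measure_of_functional L) A \<noteq> top" for A
    by (simp add: less_top)
  have "(\<lambda>n. measure_of_functional L (A n)) sums measure_of_functional L (\<Union>n. A n)"
    if A: "range A \<subseteq> borel01" "disjoint_family A" for A
  proof -
    have bor: "A n \<in> sets borel" for n using A(1) borel01_iff by blast
    have UN: "(\<Union>n. A n) \<in> borel01" using A by (intro sets.countable_UN)
    have part: "(\<Sum>i<n. L (indicator (A i))) = L (indicator (\<Union>i<n. A i))" for n
    proof -
      have "(\<lambda>x. \<Sum>i<n. indicator (A i) x :: complex) = indicator (\<Union>i<n. A i)"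
        using A(2) by (intro ext indicator_UN_disjoint[symmetric] finite_lessThan)
          (auto simp: disjoint_family_on_def)
      then show ?thesis
        using sum[of "{..<n}" "\<lambda>i. indicator (A i)"] bor by simp
    qed
    have "(\<lambda>n. L (indicator (\<Union>i<n. A i))) \<longlonglongrightarrow> L (indicator (\<Union>i. A i))"
    proof (rule lim[where B = 1])
      show "(\<lambda>n. indicator (\<Union>i<n. A i) x :: complex) \<longlonglongrightarrow> indicator (\<Union>i. A i) x" for x
        by (rule LIMSEQ_indicator_UN)
    qed (use bor in \<open>auto simp: indicator_def\<close>)
    then show ?thesis
      using A UN by (simp add: sums_def measure_of_functional_def part image_subset_iff)
  qed
  then show ?thesis
    using fin ne by (auto simp: finite_measures_def locally_finite_measures_def measure_of_functional_def)
qed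

sublocale realized: fin_measure "measure_of_functional L"
  by unfold_locales (rule measure_of_functional_finite)

text \<open>Integration against the constructed measure and L itself are two functionals with the
  same values on indicators.\<close>

lemma cint_measure_of_functional:
  assumes "h \<in> bounded_borel"
  shows "cint (measure_of_functional L) {0..<1} h = L h"
  using realized.measure_functional_cint measure_functional_axioms _ assms
  by (rule measure_functional_eqI) (simp add: realized.cint_indicator, simp add: measure_of_functional_def)

lemma mnorm_le: "mnorm (measure_of_functional L) \<le> C"
  using variation_on_le[of "{0..<1}"] C_nonneg
  by (simp add: realized.mnorm_eq measure_def realized.emeasure_mass enn2real_leI)

end

section \<open>Uniqueness and convolution\<close>

text \<open>For x < 1, piecewise linear: 1 up to x, then down to 0 at x + (1 - x) / (2 (n + 1)). For
  n = 0 this is the midpoint (1 + x) / 2 < 1, which bounds the support for all n; as n grows the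
  functions decrease to the indicator of \<open>{..x}\<close>.\<close>

definition cutoff :: "real \<Rightarrow> nat \<Rightarrow> real \<Rightarrow> complex" where
  "cutoff x n t = of_real (max 0 (1 - real (Suc n) * (2 / (1 - x)) * max 0 (t - x)))"

lemma cutoff_eq_0I:
  assumes "1 \<le> real (Suc n) * ((2 / (1 - x)) * (t - x))" "x < t"
  shows "cutoff x n t = 0"
proof -
  have "max 0 (t - x) = t - x" using assms(2) by simp
  then have "1 - real (Suc n) * (2 / (1 - x)) * max 0 (t - x) \<le> 0"
    using assms(1) by (simp only: mult.assoc diff_le_0_iff_le)
  then show ?thesis
    by (simp only: cutoff_def max_absorb1 of_real_0)
qed

lemma cutoff_eq_0:
  assumes "x < 1" "(1 + x) / 2 < t"
  shows "cutoff x n t = 0"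
proof -
  have "1 \<le> (2 / (1 - x)) * (t - x)"
    using assms by (simp add: field_simps)
  then have "1 * 1 \<le> real (Suc n) * ((2 / (1 - x)) * (t - x))"
    by (intro mult_mono) auto
  moreover have "x < t" using assms by simp
  ultimately show ?thesis
    by (intro cutoff_eq_0I) (simp_all only: mult_1)
qed

lemma cutoff_in_Cc01:
  assumes "0 \<le> x" "x < 1"
  shows "cutoff x n \<in> Cc01"
  unfolding Cc01_def
proof (intro CollectI conjI exI[of _ "{0..(1 + x) / 2}"])
  show "continuous_on {0..<1} (cutoff x n)"
    unfolding cutoff_def by (intro continuous_intros)
qed (use assms in \<open>auto simp: cutoff_eq_0\<close>)

context lfin_measure
begin

lemma additive:
  assumes "A \<in> borel01" "B \<in> borel01" "A \<inter> B = {}" "variation_on \<mu> (A \<union> B) < \<infinity>"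
  shows "\<mu> (A \<union> B) = \<mu> A + \<mu> B"
proof -
  have "(\<lambda>n. \<mu> (binaryset A B n)) sums \<mu> (\<Union>n. binaryset A B n)"
  proof (rule sums_UN)
    show "range (binaryset A B) \<subseteq> borel01"
      using assms by (auto simp: range_binaryset_eq)
    show "disjoint_family (binaryset A B)"
      using assms(3) by (auto simp: disjoint_family_on_def binaryset_def)
  qed (use assms in \<open>simp add: UN_binaryset_eq\<close>)
  moreover have "(\<lambda>n. \<mu> (binaryset A B n)) sums (\<mu> A + \<mu> B)"
    by (rule binaryset_sums) simp
  ultimately show ?thesis
    using sums_unique2 by (metis UN_binaryset_eq)
qed

text \<open>Recovers values on closed intervals from compactly supported continuous tests. Dominated
  convergence applies because all cutoffs vanish beyond y = (1 + x) / 2 and |\<mu>| has finite mass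
  up to y.\<close>

lemma measure_atMost_limit:
  assumes x: "0 \<le> x" "x < 1"
  shows "(\<lambda>n. cint \<mu> {0..<1} (cutoff x n)) \<longlonglongrightarrow> \<mu> {0..x}"
proof -
  define y where "y = (1 + x) / 2"
  have y: "0 \<le> y" "y < 1" "x < y" using x by (auto simp: y_def)
  define h where "h = cutoff x"
  have h_meas[measurable]: "h n \<in> borel_measurable borel" for n
    unfolding h_def cutoff_def by measurable
  have h_le: "norm (h n t) \<le> indicator {..y} t" for n t
  proof (cases "t \<le> y")
    case True
    have "0 \<le> real (Suc n) * (2 / (1 - x)) * max 0 (t - x)"
      using x by (intro mult_nonneg_nonneg divide_nonneg_pos) auto
    then show ?thesis using True by (simp add: h_def cutoff_def)
  next
    case False
    then show ?thesis using x by (simp add: h_def cutoff_eq_0 y_def)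
  qed
  have lim: "(\<lambda>n. h n t) \<longlonglongrightarrow> indicator {..x} t" for t
  proof (cases "t \<le> x")
    case True
    then show ?thesis by (simp add: h_def cutoff_def)
  next
    case False
    define \<delta> where "\<delta> = (2 / (1 - x)) * (t - x)"
    have "0 < \<delta>" using False x by (simp add: \<delta>_def)
    then obtain N where N: "1 < real N * \<delta>"
      using reals_Archimedean3 by blast
    have "h n t = 0" if "n \<ge> N" for n
    proof -
      have "real N * \<delta> \<le> real (Suc n) * \<delta>"
        using that \<open>0 < \<delta>\<close> by (intro mult_right_mono) auto
      then have "1 \<le> real (Suc n) * \<delta>"
        using N by linarith
      then show ?thesis
        using False unfolding h_def \<delta>_def by (intro cutoff_eq_0I) simp_all
    qed
    then have "eventually (\<lambda>n. h n t = 0) sequentially"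
      by (auto simp: eventually_sequentially)
    then show ?thesis
      using False by (simp add: tendsto_eventually)
  qed
  have "(\<lambda>n. \<integral>t. indicator {0..<1} t *\<^sub>R (h n t * dens \<mu> t) \<partial>mass \<mu>)
      \<longlonglongrightarrow> (\<integral>t. indicator {0..<1} t *\<^sub>R (indicator {..x} t * dens \<mu> t) \<partial>mass \<mu>)"
  proof (rule integral_dominated_convergence[where w = "\<lambda>t. 2 * indicator {..y} t"])
    show "integrable (mass \<mu>) (\<lambda>t. 2 * indicator {..y} t :: real)"
      using emeasure_mass_finite[of "{..y}" y] y by (simp add: integrable_indicator_iff)
    show "AE t in mass \<mu>. norm (indicator {0..<1} t *\<^sub>R (h n t * dens \<mu> t)) \<le> 2 * indicator {..y} t" for n
    proof (rule AE_I2)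
      fix t
      have "norm (h n t * dens \<mu> t) \<le> indicator {..y} t * 2"
        unfolding norm_mult by (intro mult_mono h_le norm_dens_le) auto
      then show "norm (indicator {0..<1} t *\<^sub>R (h n t * dens \<mu> t)) \<le> 2 * indicator {..y} t"
        by (auto simp: indicator_def split: if_splits)
    qed
    show "AE t in mass \<mu>. (\<lambda>n. indicator {0..<1} t *\<^sub>R (h n t * dens \<mu> t))
        \<longlonglongrightarrow> indicator {0..<1} t *\<^sub>R (indicator {..x} t * dens \<mu> t)"
      by (intro AE_I2 tendsto_intros lim)
  qed simp_all
  also have "(\<integral>t. indicator {0..<1} t *\<^sub>R (indicator {..x} t * dens \<mu> t) \<partial>mass \<mu>) =
      (\<integral>t. indicator {0..x} t * dens \<mu> t \<partial>mass \<mu>)"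
    using x by (intro Bochner_Integration.integral_cong) (auto simp: indicator_def)
  also have "\<dots> = \<mu> {0..x}"
    using x variation_on_compact_finite by (intro integral_indicator_dens) (auto simp: borel01_iff)
  finally show ?thesis
    by (simp add: cint_eq flip: h_def)
qed

end

text \<open>This gives the uniqueness in the description of \<open>convolution\<close>. Tests yield
  the values on \<open>{0..x}\<close>, a pi-lambda argument inside each \<open>{0..a}\<close> with a
  < 1 yields the Borel subsets, and countable additivity the rest. The variations are compared too,
  since a set of infinite variation has value 0 by convention.\<close>

lemma locally_finite_measure_eqI:
  assumes \<rho>: "\<rho> \<in> locally_finite_measures" "\<sigma> \<in> locally_finite_measures"
    and eq: "\<And>h. h \<in> Cc01 \<Longrightarrow> cint \<rho> {0..<1} h = cint \<sigma> {0..<1} h"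
  shows "\<rho> = \<sigma>"
proof -
  interpret \<rho>: lfin_measure \<rho> by unfold_locales fact
  interpret \<sigma>: lfin_measure \<sigma> by unfold_locales fact
  have eq_cl: "\<rho> {0..x} = \<sigma> {0..x}" if "x < 1" for x
  proof (cases "0 \<le> x")
    case True
    show ?thesis
      by (rule LIMSEQ_unique[OF \<rho>.measure_atMost_limit[OF True that, unfolded eq[OF cutoff_in_Cc01[OF True that]]]
            \<sigma>.measure_atMost_limit[OF True that]])
  qed simp
  \<comment> \<open>Intersecting with \<open>{0..a}\<close> keeps all variations finite, so
    complements are computed by subtraction and disjoint unions by countable additivity.\<close>
  have eq_Int: "\<rho> (A \<inter> {0..a}) = \<sigma> (A \<inter> {0..a})" if A: "A \<in> sets borel" and a: "a < 1" for A a
  proof -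
    have bor: "B \<inter> {0..a} \<in> borel01" if "B \<in> sets borel" for B
      using that a by (auto simp: borel01_iff)
    have cl01: "{0..a} \<in> borel01"
      using a by (auto simp: borel01_iff)
    have fin: "variation_on \<rho> (B \<inter> {0..a}) < \<infinity>" "variation_on \<sigma> (B \<inter> {0..a}) < \<infinity>"
      if "B \<in> sets borel" for B
      using le_less_trans[OF variation_on_mono[OF bor[OF that] cl01] \<rho>.variation_on_compact_finite[OF a]]
        le_less_trans[OF variation_on_mono[OF bor[OF that] cl01] \<sigma>.variation_on_compact_finite[OF a]]
      by simp_all
    have borel: "sets (borel :: real measure) = sigma_sets UNIV (range atMost)"
      by (subst borel_eq_atMost) simp
    have "Int_stable (range (atMost :: real \<Rightarrow> real set))"
      by (auto simp: Int_stable_def)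
    moreover have "range (atMost :: real \<Rightarrow> real set) \<subseteq> Pow UNIV" by simp
    moreover have "A \<in> sigma_sets UNIV (range atMost)" using A borel by simp
    ultimately show ?thesis
    proof (induction rule: sigma_sets_induct_disjoint)
      case (basic A)
      then obtain x where "A = {..x}" by blast
      then have "A \<inter> {0..a} = {0..min x a}" by auto
      then show ?case using eq_cl a by simp
    next
      case (compl A)
      then have A: "A \<in> sets borel" using borel by simp
      have un: "(A \<inter> {0..a}) \<union> ((UNIV - A) \<inter> {0..a}) = {0..a}" by blast
      have "\<rho> {0..a} = \<rho> (A \<inter> {0..a}) + \<rho> ((UNIV - A) \<inter> {0..a})"
        using A \<rho>.variation_on_compact_finite[OF a] bor
        by (subst un[symmetric], intro \<rho>.additive) (auto simp: un)
      moreover have "\<sigma> {0..a} = \<sigma> (A \<inter> {0..a}) + \<sigma> ((UNIV - A) \<inter> {0..a})"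
        using A \<sigma>.variation_on_compact_finite[OF a] bor
        by (subst un[symmetric], intro \<sigma>.additive) (auto simp: un)
      ultimately show ?case
        using eq_cl[OF a] compl.IH by simp
    next
      case (union A)
      then have A: "A n \<in> sets borel" for n using borel by auto
      have UN: "(\<Union>n. A n) \<inter> {0..a} = (\<Union>n. A n \<inter> {0..a})" by blast
      have "(\<Union>n. A n) \<in> sets borel" using A by (intro sets.countable_UN) auto
      note fin_UN = fin[OF this, unfolded UN]
      have range: "range (\<lambda>n. A n \<inter> {0..a}) \<subseteq> borel01"
        by (rule image_subsetI) (rule bor[OF A])
      have dis: "disjoint_family (\<lambda>n. A n \<inter> {0..a})"
        using union.hyps(1) unfolding disjoint_family_on_def by blast
      have "(\<lambda>n. \<rho> (A n \<inter> {0..a})) sums \<rho> (\<Union>n. A n \<inter> {0..a})"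
        by (rule \<rho>.sums_UN[OF range dis]) (rule fin_UN)
      moreover have "(\<lambda>n. \<sigma> (A n \<inter> {0..a})) sums \<sigma> (\<Union>n. A n \<inter> {0..a})"
        by (rule \<sigma>.sums_UN[OF range dis]) (rule fin_UN)
      ultimately show ?case
        unfolding UN union.IH by (rule sums_unique2)
    qed simp
  qed
  have eq_sub: "\<rho> A = \<sigma> A" if "A \<in> borel01" "A \<subseteq> exhaustion n" for A n
  proof -
    have "A \<inter> {0..1 - 1 / real (Suc n)} = A"
      using that(2) by (auto simp: exhaustion_def)
    then show ?thesis
      using eq_Int[of A "1 - 1 / real (Suc n)"] that(1) by (simp add: borel01_iff del: of_nat_Suc)
  qed
  let ?J = "disjointed exhaustion"
  have J: "A \<inter> ?J n \<in> borel01" "A \<inter> ?J n \<subseteq> exhaustion n" if "A \<in> borel01" for A n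
    using that disjointed_exhaustion_borel01 by (auto simp: disjointed_def)
  then have range: "range (\<lambda>n. A \<inter> ?J n) \<subseteq> borel01" if "A \<in> borel01" for A
    using that by (intro image_subsetI)
  have var_sub: "variation_on \<rho> A = variation_on \<sigma> A" if "A \<in> borel01" "A \<subseteq> exhaustion n" for A n
    unfolding variation_on_def
  proof (intro SUP_cong refl sum.cong arg_cong[of _ _ ennreal] arg_cong[of _ _ norm])
    fix P B assume "P \<in> {P. finite P \<and> partition_on A P \<and> P \<subseteq> borel01}" "B \<in> P"
    then have "B \<in> borel01" "B \<subseteq> A"
      unfolding partition_on_def by blast+
    then show "\<rho> B = \<sigma> B"
      by (rule eq_sub[OF _ subset_trans[OF _ that(2)]])
  qed
  \<comment> \<open>With equal variations, both measures apply the zero convention to the same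
    sets.\<close>
  have var: "variation_on \<rho> A = variation_on \<sigma> A" if A: "A \<in> borel01" for A
  proof -
    have "variation_on \<rho> (\<Union>n. A \<inter> ?J n) = variation_on \<sigma> (\<Union>n. A \<inter> ?J n)"
      unfolding \<rho>.variation_on_UN[OF range[OF A] disjoint_Int_disjointed_exhaustion]
        \<sigma>.variation_on_UN[OF range[OF A] disjoint_Int_disjointed_exhaustion]
      by (intro suminf_cong var_sub[OF J(1)[OF A] J(2)[OF A]])
    then show ?thesis by (simp only: UN_Int_disjointed_exhaustion[OF A])
  qed
  show ?thesis
  proof
    fix A
    show "\<rho> A = \<sigma> A"
    proof (cases "A \<in> borel01 \<and> variation_on \<rho> A < \<infinity>")
      case True
      then have A: "A \<in> borel01" and fin: "variation_on \<rho> A < \<infinity>" "variation_on \<sigma> A < \<infinity>"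
        using var by auto
      have "(\<lambda>n. \<rho> (A \<inter> ?J n)) sums \<rho> (\<Union>n. A \<inter> ?J n)"
        using fin unfolding UN_Int_disjointed_exhaustion[OF A]
        by (intro \<rho>.sums_UN[OF range[OF A] disjoint_Int_disjointed_exhaustion, unfolded UN_Int_disjointed_exhaustion[OF A]])
      moreover have "(\<lambda>n. \<sigma> (A \<inter> ?J n)) sums \<sigma> (\<Union>n. A \<inter> ?J n)"
        using fin unfolding UN_Int_disjointed_exhaustion[OF A]
        by (intro \<sigma>.sums_UN[OF range[OF A] disjoint_Int_disjointed_exhaustion, unfolded UN_Int_disjointed_exhaustion[OF A]])
      moreover have "\<rho> (A \<inter> ?J n) = \<sigma> (A \<inter> ?J n)" for n
        using J[OF A] by (rule eq_sub)
      ultimately show ?thesis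
        unfolding UN_Int_disjointed_exhaustion[OF A] by (simp only: sums_unique2)
    next
      case False
      then have "A \<notin> borel01 \<or> variation_on \<rho> A = \<infinity>" "A \<notin> borel01 \<or> variation_on \<sigma> A = \<infinity>"
        using var[of A] less_top[of "variation_on \<rho> A"] by auto
      from \<rho>.eq_0[OF this(1)] \<sigma>.eq_0[OF this(2)] show ?thesis by simp
    qed
  qed
qed

lemma convolution_eqI:
  assumes "\<rho> \<in> locally_finite_measures"
    and "\<And>h. h \<in> Cc01 \<Longrightarrow> cint \<rho> {0..<1} h = cint \<nu> {0..<1} (\<lambda>t. cint \<mu> {0..<1 - t} (\<lambda>s. h (t + s)))"
  shows "convolution \<nu> \<mu> = \<rho>"
  unfolding convolution_def
proof (rule the_equality)
  show "\<rho> \<in> locally_finite_measures \<and>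
      (\<forall>h\<in>Cc01. cint \<rho> {0..<1} h = cint \<nu> {0..<1} (\<lambda>t. cint \<mu> {0..<1 - t} (\<lambda>s. h (t + s))))"
    using assms by blast
  fix \<sigma> assume \<sigma>: "\<sigma> \<in> locally_finite_measures \<and>
      (\<forall>h\<in>Cc01. cint \<sigma> {0..<1} h = cint \<nu> {0..<1} (\<lambda>t. cint \<mu> {0..<1 - t} (\<lambda>s. h (t + s))))"
  show "\<sigma> = \<rho>"
  proof (rule locally_finite_measure_eqI)
    show "\<sigma> \<in> locally_finite_measures" by (rule conjunct1[OF \<sigma>])
    show "\<rho> \<in> locally_finite_measures" by fact
    fix h assume h: "h \<in> Cc01"
    from bspec[OF conjunct2[OF \<sigma>] h] assms(2)[OF h, symmetric]
    show "cint \<sigma> {0..<1} h = cint \<rho> {0..<1} h" by (rule trans)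
  qed
qed

text \<open>Members of \<open>Cc01\<close> are arbitrary outside [0,1); multiplying by the indicator
  makes them bounded Borel functions on the line. The number a is an upper bound of the compact
  support.\<close>

lemma Cc01E:
  assumes "h \<in> Cc01"
  obtains a where "0 \<le> a" "a < 1" "\<And>t. t \<in> {0..<1} \<Longrightarrow> a < t \<Longrightarrow> h t = 0"
    "(\<lambda>t. indicator {0..<1} t * h t) \<in> bounded_borel"
proof -
  obtain K where K: "compact K" "K \<subseteq> {0..<1}" "\<And>t. t \<in> {0..<1} - K \<Longrightarrow> h t = 0"
    and cont: "continuous_on {0..<1} h"
    using assms by (auto simp: Cc01_def)
  obtain a where a: "0 \<le> a" "a < 1" "\<And>t. t \<in> K \<Longrightarrow> t \<le> a"
  proof (cases "K = {}")
    case False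
    then obtain a where "a \<in> K" "\<And>t. t \<in> K \<Longrightarrow> t \<le> a"
      using compact_attains_sup[OF K(1)] by blast
    then show ?thesis using K(2) that[of a] by auto
  qed (use that[of 0] in auto)
  have "compact (h ` K)"
    using K(1,2) cont by (intro compact_continuous_image) (rule continuous_on_subset)
  then obtain B where B: "\<And>t. t \<in> K \<Longrightarrow> norm (h t) \<le> B"
    using compact_imp_bounded by (force simp: bounded_iff)
  have "norm (indicator {0..<1} t * h t) \<le> max 0 B" for t
    using B[of t] K(3)[of t] by (cases "t \<in> K") (auto simp: indicator_def)
  moreover have "(\<lambda>t. indicator {0..<1} t *\<^sub>R h t) \<in> borel_measurable borel"
    using cont by (intro borel_measurable_continuous_on_indicator) auto
  then have "(\<lambda>t. indicator {0..<1} t * h t) \<in> borel_measurable borel"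
    by (simp add: scaleR_conv_of_real of_real_indicator)
  ultimately have "(\<lambda>t. indicator {0..<1} t * h t) \<in> bounded_borel"
    by (intro bounded_borelI)
  moreover have "h t = 0" if "t \<in> {0..<1}" "a < t" for t
    using K(3)[of t] a(3)[of t] that by auto
  ultimately show ?thesis using that a(1,2) by blast
qed

text \<open>The transpose of \<open>\<nu> \<mapsto> \<nu> * \<mu>\<close>.\<close>

definition conv_transpose :: "cmeasure \<Rightarrow> (real \<Rightarrow> complex) \<Rightarrow> real \<Rightarrow> complex" where
  "conv_transpose \<mu> h t = (if t \<in> {0..<1} then cint \<mu> {0..<1 - t} (\<lambda>s. h (t + s)) else 0)"

lemma conv_transpose_outside: "t \<notin> {0..<1} \<Longrightarrow> conv_transpose \<mu> h t = 0"
  unfolding conv_transpose_def by (rule if_not_P)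

text \<open>It suffices to test on functions supported in some \<open>{0..a}\<close> with a < 1, for
  which the transpose stays bounded even if \<mu> has infinite mass. The conclusion is much stronger
  than the test: L now gives the integrals of all bounded Borel functions.\<close>

lemma convolution_eq_measure_of_functional:
  assumes "measure_functional L C" and \<nu>: "\<nu> \<in> locally_finite_measures" and \<mu>: "\<mu> \<in> locally_finite_measures"
    and eq: "\<And>h a. h \<in> bounded_borel \<Longrightarrow> 0 \<le> a \<Longrightarrow> a < 1 \<Longrightarrow> (\<And>t. t \<notin> {0..a} \<Longrightarrow> h t = 0) \<Longrightarrow>
      cint \<nu> {0..<1} (conv_transpose \<mu> h) = L h"
  shows "convolution \<nu> \<mu> = measure_of_functional L"
proof (rule convolution_eqI)
  interpret measure_functional L C by fact
  show "measure_of_functional L \<in> locally_finite_measures"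
    by (rule realized.locally_finite)
  fix h assume "h \<in> Cc01"
  then obtain a where a: "0 \<le> a" "a < 1" "\<And>t. t \<in> {0..<1} \<Longrightarrow> a < t \<Longrightarrow> h t = 0"
    and bb: "(\<lambda>t. indicator {0..<1} t * h t) \<in> bounded_borel"
    by (rule Cc01E) blast
  have "cint (measure_of_functional L) {0..<1} h =
      cint (measure_of_functional L) {0..<1} (\<lambda>t. indicator {0..<1} t * h t)"
    by (intro cint_cong realized.locally_finite) simp
  also have "\<dots> = L (\<lambda>t. indicator {0..<1} t * h t)"
    by (rule cint_measure_of_functional[OF bb])
  also have "\<dots> = cint \<nu> {0..<1} (conv_transpose \<mu> (\<lambda>t. indicator {0..<1} t * h t))"
    using a by (intro eq[OF bb a(1,2), symmetric]) (auto simp: indicator_def)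
  also have "\<dots> = cint \<nu> {0..<1} (\<lambda>t. cint \<mu> {0..<1 - t} (\<lambda>s. h (t + s)))"
    by (intro cint_cong \<nu>) (auto simp: conv_transpose_def intro!: cint_cong \<mu>)
  finally show "cint (measure_of_functional L) {0..<1} h =
      cint \<nu> {0..<1} (\<lambda>t. cint \<mu> {0..<1 - t} (\<lambda>s. h (t + s)))" .
qed

section \<open>The transposed convolution with a locally finite measure\<close>

context lfin_measure
begin

lemma conv_transpose_eq:
  assumes [measurable]: "h \<in> borel_measurable borel" and "t \<in> {0..<1}"
  shows "conv_transpose \<mu> h t = (\<integral>s. indicator {0..<1 - t} s *\<^sub>R (h (t + s) * dens \<mu> s) \<partial>mass \<mu>)"
  using assms(2) by (simp add: conv_transpose_def cint_eq)

text \<open>A parameter integral: the indicator of the moving interval is rewritten as a condition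
  on the pair (t, s), which makes the integrand jointly Borel.\<close>

lemma borel_measurable_conv_transpose [measurable (raw)]:
  assumes [measurable]: "h \<in> borel_measurable borel"
  shows "conv_transpose \<mu> h \<in> borel_measurable borel"
proof -
  have "(\<lambda>(t, s). (if 0 \<le> s \<and> s < 1 - t then 1 else 0) *\<^sub>R (h (t + s) * dens \<mu> s))
      \<in> borel_measurable (borel \<Otimes>\<^sub>M borel)"
    by measurable
  then have "(\<lambda>(t, s). (if 0 \<le> s \<and> s < 1 - t then 1 else 0) *\<^sub>R (h (t + s) * dens \<mu> s))
      \<in> borel_measurable (borel \<Otimes>\<^sub>M mass \<mu>)"
    by (simp only: measurable_cong_sets[OF sets_pair_measure_cong[OF refl sets_mass] refl])
  then have [measurable]: "(\<lambda>t. \<integral>s. (if 0 \<le> s \<and> s < 1 - t then 1 else 0) *\<^sub>R (h (t + s) * dens \<mu> s) \<partial>mass \<mu>)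
      \<in> borel_measurable borel"
    by (rule mass.borel_measurable_lebesgue_integral)
  have "conv_transpose \<mu> h = (\<lambda>t. if t \<in> {0..<1} then
      \<integral>s. (if 0 \<le> s \<and> s < 1 - t then 1 else 0) *\<^sub>R (h (t + s) * dens \<mu> s) \<partial>mass \<mu> else 0)"
  proof
    fix t
    have "conv_transpose \<mu> h t = (\<integral>s. (if 0 \<le> s \<and> s < 1 - t then 1 else 0) *\<^sub>R (h (t + s) * dens \<mu> s) \<partial>mass \<mu>)"
      if "t \<in> {0..<1}"
      unfolding conv_transpose_eq[OF assms that]
      by (intro Bochner_Integration.integral_cong refl) (simp add: indicator_def)
    then show "conv_transpose \<mu> h t = (if t \<in> {0..<1} then
      \<integral>s. (if 0 \<le> s \<and> s < 1 - t then 1 else 0) *\<^sub>R (h (t + s) * dens \<mu> s) \<partial>mass \<mu> else 0)"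
      using conv_transpose_outside by presburger
  qed
  also have "\<dots> \<in> borel_measurable borel"
    by measurable
  finally show ?thesis .
qed

text \<open>The finiteness hypothesis always holds for t > 0. At t = 0 the integral runs over all of
  [0,1), where \<mu> may have infinite mass.\<close>

lemma conv_transpose_bounds:
  assumes h: "h \<in> borel_measurable borel" "\<And>x. norm (h x) \<le> B"
    and t: "t \<in> {0..<1}" and fin: "emeasure (mass \<mu>) {0..<1 - t} < \<infinity>"
  shows integrable_conv_transpose:
      "integrable (mass \<mu>) (\<lambda>s. indicator {0..<1 - t} s *\<^sub>R (h (t + s) * dens \<mu> s))"
    and norm_conv_transpose_le: "norm (conv_transpose \<mu> h t) \<le> 2 * B * measure (mass \<mu>) {0..<1 - t}"
  using integrable_dens[OF _ _ fin, of "\<lambda>s. h (t + s)" B] h t by (simp_all add: conv_transpose_eq)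

lemma conv_transpose_add:
  assumes "f \<in> bounded_borel" "g \<in> bounded_borel"
    and t: "t \<in> {0..<1} \<Longrightarrow> emeasure (mass \<mu>) {0..<1 - t} < \<infinity>"
  shows "conv_transpose \<mu> (\<lambda>x. f x + g x) t = conv_transpose \<mu> f t + conv_transpose \<mu> g t"
proof (cases "t \<in> {0..<1}")
  case True
  obtain B where B: "f \<in> borel_measurable borel" "\<And>x. norm (f x) \<le> B"
    using assms(1) by (rule bounded_borelE) blast
  obtain C where C: "g \<in> borel_measurable borel" "\<And>x. norm (g x) \<le> C"
    using assms(2) by (rule bounded_borelE) blast
  show ?thesis
    using integrable_conv_transpose[OF B True t[OF True]] integrable_conv_transpose[OF C True t[OF True]] True B(1) C(1)
    by (simp add: conv_transpose_eq distrib_right scaleR_add_right)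
qed (simp add: conv_transpose_outside)

lemma conv_transpose_scale:
  assumes "f \<in> bounded_borel"
  shows "conv_transpose \<mu> (\<lambda>x. c * f x) t = c * conv_transpose \<mu> f t"
proof (cases "t \<in> {0..<1}")
  case True
  note [measurable] = bounded_borel_measurable[OF assms]
  show ?thesis
    using True by (simp add: conv_transpose_eq mult.assoc mult_scaleR_right[symmetric] del: mult_scaleR_right)
qed (simp add: conv_transpose_outside)

lemma conv_transpose_local:
  assumes "f \<in> bounded_borel"
  shows "conv_transpose \<mu> (\<lambda>x. indicator {0..<1} x * f x) t = conv_transpose \<mu> f t"
  unfolding conv_transpose_def by (auto simp: indicator_def intro!: cint_cong locally_finite)

lemma conv_transpose_lim:
  assumes F: "\<And>n. F n \<in> borel_measurable borel" "\<And>n x. norm (F n x) \<le> B" "\<And>x. (\<lambda>n. F n x) \<longlonglongrightarrow> f x"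
    and t: "t \<in> {0..<1} \<Longrightarrow> emeasure (mass \<mu>) {0..<1 - t} < \<infinity>"
  shows "(\<lambda>n. conv_transpose \<mu> (F n) t) \<longlonglongrightarrow> conv_transpose \<mu> f t"
proof (cases "t \<in> {0..<1}")
  case True
  note [measurable] = F(1)
  have [measurable]: "f \<in> borel_measurable borel"
    using F(1,3) by (rule borel_measurable_LIMSEQ_metric)
  show ?thesis
    unfolding conv_transpose_eq[OF F(1) True] conv_transpose_eq[OF \<open>f \<in> borel_measurable borel\<close> True]
  proof (rule integral_dominated_convergence[where w = "\<lambda>s. 2 * B * indicator {0..<1 - t} s"])
    show "integrable (mass \<mu>) (\<lambda>s. 2 * B * indicator {0..<1 - t} s :: real)"
      using t[OF True] by (simp add: integrable_indicator_iff)
    show "AE s in mass \<mu>. norm (indicator {0..<1 - t} s *\<^sub>R (F n (t + s) * dens \<mu> s)) \<le>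
        2 * B * indicator {0..<1 - t} s" for n
    proof (rule AE_I2)
      fix s
      have "norm (F n (t + s) * dens \<mu> s) \<le> B * 2"
        unfolding norm_mult using order_trans[OF norm_ge_zero F(2)]
        by (intro mult_mono F norm_dens_le) auto
      then show "norm (indicator {0..<1 - t} s *\<^sub>R (F n (t + s) * dens \<mu> s)) \<le>
          2 * B * indicator {0..<1 - t} s"
        by (auto simp: indicator_def)
    qed
    show "AE s in mass \<mu>. (\<lambda>n. indicator {0..<1 - t} s *\<^sub>R (F n (t + s) * dens \<mu> s))
        \<longlonglongrightarrow> indicator {0..<1 - t} s *\<^sub>R (f (t + s) * dens \<mu> s)"
      by (intro AE_I2 tendsto_intros F)
  qed simp_all
qed (simp add: conv_transpose_outside)

text \<open>If h vanishes beyond a, only s <= a - t <= a contributes, so the mass of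
  \<open>{0..a}\<close> bounds the integral uniformly in t, with t = 0 included.\<close>

lemma bounded_borel_conv_transpose_compact:
  assumes h: "h \<in> bounded_borel" and a: "a < 1" and supp: "\<And>t. t \<notin> {0..a} \<Longrightarrow> h t = 0"
  shows "conv_transpose \<mu> h \<in> bounded_borel"
proof -
  obtain B where B: "h \<in> borel_measurable borel" "\<And>x. norm (h x) \<le> B"
    using h by (rule bounded_borelE) blast
  have B0: "0 \<le> B" using order_trans[OF norm_ge_zero B(2)] .
  have "norm (conv_transpose \<mu> h t) \<le> 2 * B * measure (mass \<mu>) {0..a}" for t
  proof (cases "t \<in> {0..<1}")
    case True
    have "conv_transpose \<mu> h t = (\<integral>s. indicator {0..a} s *\<^sub>R ((indicator {0..<1 - t} s * h (t + s)) * dens \<mu> s) \<partial>mass \<mu>)"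
      unfolding conv_transpose_eq[OF B(1) True] using supp True
      by (intro Bochner_Integration.integral_cong) (auto simp: indicator_def)
    also have "norm \<dots> \<le> 2 * B * measure (mass \<mu>) {0..a}"
    proof (rule integrable_dens(2))
      show "emeasure (mass \<mu>) {0..a} < \<infinity>"
        using emeasure_mass_finite[of "{0..a}" a] a by auto
      show "(\<lambda>s. indicator {0..<1 - t} s * h (t + s)) \<in> borel_measurable borel"
        using B(1) by measurable
    qed (use B(2) B0 in \<open>auto simp: indicator_def\<close>)
    finally show ?thesis .
  qed (use B0 in \<open>simp add: conv_transpose_outside\<close>)
  then show ?thesis
    using B(1) by (intro bounded_borelI) measurable
qed

end

section \<open>The derivation on measures\<close>

lemma cint_cong_indicator:
  assumes "\<And>x. x \<in> {0..<1} \<Longrightarrow> indicator S x *\<^sub>R h x = indicator S' x *\<^sub>R h' x"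
    and "\<mu> \<in> locally_finite_measures"
  shows "cint \<mu> S h = cint \<mu> S' h'"
proof -
  interpret lfin_measure \<mu> by unfold_locales fact
  have "indicator S x *\<^sub>R (h x * polar_density \<mu> x) = indicator S' x *\<^sub>R (h' x * polar_density \<mu> x)"
    if "x \<in> {0..<1}" for x
    using arg_cong[OF assms(1)[OF that], of "\<lambda>z. z * polar_density \<mu> x"] by simp
  then show ?thesis
    unfolding cint_def set_lebesgue_integral_def
    by (intro Bochner_Integration.integral_cong refl) simp
qed

lemma finite_measure_eqI:
  assumes "a \<in> finite_measures" "b \<in> finite_measures"
    and eq: "\<And>h. h \<in> bounded_borel \<Longrightarrow> cint a {0..<1} h = cint b {0..<1} h"
  shows "a = b"
proof
  fix A
  interpret a: fin_measure a by unfold_locales fact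
  interpret b: fin_measure b by unfold_locales fact
  show "a A = b A"
  proof (cases "A \<in> borel01")
    case True
    then have "cint a {0..<1} (indicator A) = cint b {0..<1} (indicator A)"
      by (intro eq bounded_borel_indicator) (simp add: borel01_iff)
    then show ?thesis
      using True by (simp add: a.cint_indicator b.cint_indicator)
  qed (simp add: a.eq_0 b.eq_0)
qed

text \<open>Polar densities do not add, so additivity of the integral in the measure is obtained by
  realizing the sum of the two functionals as a measure.\<close>

lemma add_finite_measures:
  assumes "a \<in> finite_measures" "b \<in> finite_measures"
  shows "(\<lambda>A. a A + b A) \<in> finite_measures"
    and "h \<in> bounded_borel \<Longrightarrow> cint (\<lambda>A. a A + b A) {0..<1} h = cint a {0..<1} h + cint b {0..<1} h"
proof -
  interpret a: fin_measure a by unfold_locales fact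
  interpret b: fin_measure b by unfold_locales fact
  interpret L: measure_functional "\<lambda>h. cint a {0..<1} h + cint b {0..<1} h" "2 * mnorm a + 2 * mnorm b"
    by (intro measure_functional_add a.measure_functional_cint b.measure_functional_cint)
  have "(\<lambda>A. a A + b A) = measure_of_functional (\<lambda>h. cint a {0..<1} h + cint b {0..<1} h)"
    by (auto simp: fun_eq_iff measure_of_functional_def a.cint_indicator b.cint_indicator a.eq_0 b.eq_0)
  then show "(\<lambda>A. a A + b A) \<in> finite_measures"
    "h \<in> bounded_borel \<Longrightarrow> cint (\<lambda>A. a A + b A) {0..<1} h = cint a {0..<1} h + cint b {0..<1} h"
    using L.measure_of_functional_finite L.cint_measure_of_functional by simp_all
qed

lemma measure_functional_scale:
  assumes "measure_functional K C"
  shows "measure_functional (\<lambda>h. c * K h) (norm c * C)"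
proof -
  interpret K: measure_functional K C by fact
  show ?thesis
  proof
    fix h :: "real \<Rightarrow> complex" and B assume h: "h \<in> borel_measurable borel" "\<And>x. norm (h x) \<le> B"
    show "norm (c * K h) \<le> norm c * C * B"
      using K.norm_le[OF h] by (simp add: norm_mult mult.assoc mult_left_mono)
  next
    fix F :: "nat \<Rightarrow> real \<Rightarrow> complex" and f B
    assume F: "\<And>n. F n \<in> borel_measurable borel" "\<And>n x. norm (F n x) \<le> B" "\<And>x. (\<lambda>n. F n x) \<longlonglongrightarrow> f x"
    show "(\<lambda>n. c * K (F n)) \<longlonglongrightarrow> c * K f"
      by (rule tendsto_mult[OF tendsto_const K.lim[OF F]])
  qed (simp_all add: K.add K.scale K.local distrib_left)
qed

lemma scale_finite_measures:
  assumes "a \<in> finite_measures"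
  shows "(\<lambda>A. c * a A) \<in> finite_measures"
    and "h \<in> bounded_borel \<Longrightarrow> cint (\<lambda>A. c * a A) {0..<1} h = c * cint a {0..<1} h"
proof -
  interpret a: fin_measure a by unfold_locales fact
  interpret L: measure_functional "\<lambda>h. c * cint a {0..<1} h" "norm c * (2 * mnorm a)"
    by (intro measure_functional_scale a.measure_functional_cint)
  have "(\<lambda>A. c * a A) = measure_of_functional (\<lambda>h. c * cint a {0..<1} h)"
    by (auto simp: fun_eq_iff measure_of_functional_def a.cint_indicator a.eq_0)
  then show "(\<lambda>A. c * a A) \<in> finite_measures"
    "h \<in> bounded_borel \<Longrightarrow> cint (\<lambda>A. c * a A) {0..<1} h = c * cint a {0..<1} h"
    using L.measure_of_functional_finite L.cint_measure_of_functional by simp_all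
qed

context fin_measure
begin

lemma emeasure_mass_less_top: "emeasure (mass \<nu>) A < \<infinity>"
  using mass.emeasure_finite[of A] by (simp add: less_top[symmetric])

lemma norm_conv_transpose_le_mnorm:
  assumes h: "h \<in> borel_measurable borel" "\<And>x. norm (h x) \<le> B"
  shows "norm (conv_transpose \<nu> h t) \<le> 2 * mnorm \<nu> * B"
proof (cases "t \<in> {0..<1}")
  case True
  have "0 \<le> B" using order_trans[OF norm_ge_zero h(2)] .
  have "norm (conv_transpose \<nu> h t) \<le> 2 * B * measure (mass \<nu>) {0..<1 - t}"
    by (rule norm_conv_transpose_le[OF h True emeasure_mass_less_top])
  also have "\<dots> \<le> 2 * B * mnorm \<nu>"
    unfolding mnorm_eq using \<open>0 \<le> B\<close> by (intro mult_left_mono mass.finite_measure_mono) auto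
  finally show ?thesis by (simp add: mult_ac)
next
  case False
  then show ?thesis
    using order_trans[OF norm_ge_zero h(2)] by (simp add: conv_transpose_outside mnorm_eq)
qed

end

text \<open>For a finite right factor the transpose is bounded at every t, 0 included, so the
  defining identity extends from \<open>Cc01\<close> to all bounded Borel h.\<close>

lemma convolution_finite_measures:
  assumes "\<nu> \<in> finite_measures" "\<mu> \<in> finite_measures"
  shows convolution_in_finite_measures: "convolution \<nu> \<mu> \<in> finite_measures"
    and cint_convolution: "h \<in> bounded_borel \<Longrightarrow>
      cint (convolution \<nu> \<mu>) {0..<1} h = cint \<nu> {0..<1} (conv_transpose \<mu> h)"
proof -
  interpret \<nu>: fin_measure \<nu> by unfold_locales fact
  interpret \<mu>: fin_measure \<mu> by unfold_locales fact
  interpret L: measure_functional "\<lambda>h. cint \<nu> {0..<1} (conv_transpose \<mu> h)" "2 * mnorm \<nu> * (2 * mnorm \<mu>)"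
  proof (rule measure_functional_compose[OF \<nu>.measure_functional_cint])
    show "0 \<le> 2 * mnorm \<mu>"
      by (simp add: \<mu>.mnorm_eq)
    show "conv_transpose \<mu> h \<in> borel_measurable borel" if "h \<in> bounded_borel" for h
      using that by (intro \<mu>.borel_measurable_conv_transpose bounded_borel_measurable)
  qed (rule \<mu>.norm_conv_transpose_le_mnorm \<mu>.conv_transpose_add[OF _ _ \<mu>.emeasure_mass_less_top]
      \<mu>.conv_transpose_scale \<mu>.conv_transpose_lim[OF _ _ _ \<mu>.emeasure_mass_less_top]
      \<mu>.conv_transpose_local; assumption)+
  have "convolution \<nu> \<mu> = measure_of_functional (\<lambda>h. cint \<nu> {0..<1} (conv_transpose \<mu> h))"
    by (rule convolution_eq_measure_of_functional[OF L.measure_functional_axioms \<nu>.locally_finite \<mu>.locally_finite]) simp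
  then show "convolution \<nu> \<mu> \<in> finite_measures"
    "h \<in> bounded_borel \<Longrightarrow> cint (convolution \<nu> \<mu>) {0..<1} h = cint \<nu> {0..<1} (conv_transpose \<mu> h)"
    using L.measure_of_functional_finite L.cint_measure_of_functional by simp_all
qed

lemma bounded_borel_cint:
  assumes "b \<in> finite_measures"
    and F: "case_prod F \<in> borel_measurable (borel \<Otimes>\<^sub>M borel)" "\<And>t u. norm (F t u) \<le> B"
  shows "(\<lambda>t. cint b {0..<1} (F t)) \<in> bounded_borel"
    and "F t \<in> bounded_borel"
proof -
  interpret b: fin_measure b by unfold_locales fact
  interpret K: measure_functional "\<lambda>h. cint b {0..<1} h" "2 * mnorm b"
    by (rule b.measure_functional_cint)
  have F1: "F t \<in> borel_measurable borel" for t
    using measurable_compose[OF _ F(1), of "\<lambda>u. (t, u)" borel] by simp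
  then show "F t \<in> bounded_borel"
    using F(2) by (rule bounded_borelI)
  note [measurable] = F(1)
  have "(\<lambda>(t, u). F t u * dens b u) \<in> borel_measurable (borel \<Otimes>\<^sub>M borel)"
    by measurable
  then have "(\<lambda>(t, u). F t u * dens b u) \<in> borel_measurable (borel \<Otimes>\<^sub>M mass b)"
    by (simp only: measurable_cong_sets[OF sets_pair_measure_cong[OF refl sets_mass] refl])
  then have "(\<lambda>t. \<integral>u. F t u * dens b u \<partial>mass b) \<in> borel_measurable borel"
    by (rule b.mass.borel_measurable_lebesgue_integral)
  then show "(\<lambda>t. cint b {0..<1} (F t)) \<in> bounded_borel"
    unfolding b.cint_eq_integral[OF F1, symmetric]
    using K.norm_le[OF F1 F(2)] by (rule bounded_borelI)
qed

text \<open>Fubini for the product of two finite variation measures; F and both densities are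
  bounded, so the integrand is integrable.\<close>

lemma cint_swap:
  assumes "a \<in> finite_measures" "b \<in> finite_measures"
    and F: "case_prod F \<in> borel_measurable (borel \<Otimes>\<^sub>M borel)" "\<And>t u. norm (F t u) \<le> B"
  shows "cint a {0..<1} (\<lambda>t. cint b {0..<1} (\<lambda>u. F t u)) = cint b {0..<1} (\<lambda>u. cint a {0..<1} (\<lambda>t. F t u))"
proof -
  interpret a: fin_measure a by unfold_locales fact
  interpret b: fin_measure b by unfold_locales fact
  interpret ab: pair_sigma_finite "mass a" "mass b" ..
  interpret P: finite_measure "mass a \<Otimes>\<^sub>M mass b"
    by (rule finite_measure_pair_measure) unfold_locales
  have F': "case_prod (\<lambda>u t. F t u) \<in> borel_measurable (borel \<Otimes>\<^sub>M borel)"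
    using measurable_compose[OF measurable_pair_swap' F(1)] by (simp add: case_prod_unfold)
  note [measurable] = F(1)
  have int: "integrable (mass a \<Otimes>\<^sub>M mass b) (\<lambda>(t, u). F t u * dens b u * dens a t)"
  proof (rule P.integrable_const_bound[of _ "B * 2 * 2"])
    have "(\<lambda>(t, u). F t u * dens b u * dens a t) \<in> borel_measurable (borel \<Otimes>\<^sub>M borel)"
      by measurable
    then show "(\<lambda>(t, u). F t u * dens b u * dens a t) \<in> borel_measurable (mass a \<Otimes>\<^sub>M mass b)"
      by (simp only: measurable_cong_sets[OF sets_pair_measure_cong[OF sets_mass sets_mass] refl])
    have "norm (F t u * dens b u * dens a t) \<le> B * 2 * 2" for t u
      unfolding norm_mult using order_trans[OF norm_ge_zero F(2)]
      by (intro mult_mono F(2) norm_dens_le) auto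
    then show "AE x in mass a \<Otimes>\<^sub>M mass b. norm (case x of (t, u) \<Rightarrow> F t u * dens b u * dens a t) \<le> B * 2 * 2"
      by (intro AE_I2) (auto split: prod.split)
  qed
  have "cint a {0..<1} (\<lambda>t. cint b {0..<1} (\<lambda>u. F t u)) = (\<integral>t. \<integral>u. F t u * dens b u * dens a t \<partial>mass b \<partial>mass a)"
    using bounded_borel_cint[OF assms(2) F] by (simp add: a.cint_eq_integral b.cint_eq_integral bounded_borel_measurable)
  also have "\<dots> = (\<integral>u. \<integral>t. F t u * dens b u * dens a t \<partial>mass a \<partial>mass b)"
    by (rule ab.Fubini_integral[OF int, symmetric])
  also have "\<dots> = (\<integral>u. \<integral>t. F t u * dens a t * dens b u \<partial>mass a \<partial>mass b)"
    by (simp only: mult_ac)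
  also have "\<dots> = cint b {0..<1} (\<lambda>u. cint a {0..<1} (\<lambda>t. F t u))"
    using bounded_borel_cint[OF assms(1) F' F(2)] by (simp add: a.cint_eq_integral b.cint_eq_integral bounded_borel_measurable)
  finally show ?thesis .
qed

text \<open>The transpose treats the two factors differently. An integrand symmetric in t and u, cut
  off at t + u < 1, reduces the claim to exchanging the integrals.\<close>

lemma convolution_commute:
  assumes "a \<in> finite_measures" "b \<in> finite_measures"
  shows "convolution a b = convolution b a"
proof (rule finite_measure_eqI)
  fix h assume "h \<in> bounded_borel"
  then obtain B where B: "h \<in> borel_measurable borel" "\<And>x. norm (h x) \<le> B"
    by (rule bounded_borelE) blast
  note [measurable] = B(1)
  define F where "F t u = (if t + u < 1 then h (t + u) else 0)" for t u
  have F: "case_prod F \<in> borel_measurable (borel \<Otimes>\<^sub>M borel)" "norm (F t u) \<le> B" for t u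
    using order_trans[OF norm_ge_zero B(2)] B(2) unfolding F_def by (measurable, simp)
  have eq: "cint (convolution a b) {0..<1} h = cint a {0..<1} (\<lambda>t. cint b {0..<1} (\<lambda>u. F t u))"
    if a: "a \<in> finite_measures" and b: "b \<in> finite_measures" for a b
  proof -
    interpret a: fin_measure a by unfold_locales fact
    interpret b: fin_measure b by unfold_locales fact
    show ?thesis
      unfolding cint_convolution[OF a b \<open>h \<in> bounded_borel\<close>]
      by (intro cint_cong a.locally_finite)
        (auto simp: conv_transpose_def F_def indicator_def intro!: cint_cong_indicator b.locally_finite)
  qed
  show "cint (convolution a b) {0..<1} h = cint (convolution b a) {0..<1} h"
  proof -
    have "F t u = F u t" for t u by (simp add: F_def add.commute)
    then have "(\<lambda>u. cint a {0..<1} (\<lambda>t. F t u)) = (\<lambda>u. cint a {0..<1} (\<lambda>t. F u t))"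
      by presburger
    then show ?thesis
      unfolding eq[OF assms] eq[OF assms(2,1)] cint_swap[OF assms F] by (rule arg_cong)
  qed
qed (intro convolution_in_finite_measures assms)+

text \<open>The coordinate is unbounded on the line; multiplied by the indicator of [0,1) it is
  bounded by 1, hence the factor 1 in the constant.\<close>

lemma Xmult_finite_measures:
  assumes "\<nu> \<in> finite_measures"
  shows Xmult_in_finite_measures: "Xmult \<nu> \<in> finite_measures"
    and cint_Xmult: "h \<in> bounded_borel \<Longrightarrow>
      cint (Xmult \<nu>) {0..<1} h = cint \<nu> {0..<1} (\<lambda>x. indicator {0..<1} x * of_real x * h x)"
proof -
  interpret \<nu>: fin_measure \<nu> by unfold_locales fact
  interpret L: measure_functional "\<lambda>h. cint \<nu> {0..<1} (\<lambda>x. indicator {0..<1} x * of_real x * h x)" "2 * mnorm \<nu> * 1"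
  proof (rule measure_functional_compose[OF \<nu>.measure_functional_cint])
    fix h :: "real \<Rightarrow> complex" and B x
    assume h: "\<And>x. norm (h x) \<le> B"
    have "norm (indicator {0..<1} x * of_real x * h x) \<le> 1 * B"
      unfolding norm_mult using order_trans[OF norm_ge_zero h]
      by (intro mult_mono h) (auto simp: indicator_def)
    then show "norm (indicator {0..<1} x * of_real x * h x) \<le> 1 * B" .
  next
    fix F :: "nat \<Rightarrow> real \<Rightarrow> complex" and f and x :: real
    assume "\<And>x. (\<lambda>n. F n x) \<longlonglongrightarrow> f x"
    then show "(\<lambda>n. indicator {0..<1} x * of_real x * F n x) \<longlonglongrightarrow> indicator {0..<1} x * of_real x * f x"
      by (intro tendsto_mult tendsto_const)
  qed (auto simp: algebra_simps indicator_def)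
  have "Xmult \<nu> = measure_of_functional (\<lambda>h. cint \<nu> {0..<1} (\<lambda>x. indicator {0..<1} x * of_real x * h x))"
    by (auto simp: fun_eq_iff measure_of_functional_def Xmult_def indicator_def borel01_iff
        intro!: cint_cong_indicator \<nu>.locally_finite)
  then show "Xmult \<nu> \<in> finite_measures"
    "h \<in> bounded_borel \<Longrightarrow> cint (Xmult \<nu>) {0..<1} h = cint \<nu> {0..<1} (\<lambda>x. indicator {0..<1} x * of_real x * h x)"
    using L.measure_of_functional_finite L.cint_measure_of_functional by simp_all
qed

section \<open>The transpose P under the growth condition\<close>

locale volterra_measure = lfin_measure +
  fixes C :: real
  assumes mult_variation_le: "0 < t \<Longrightarrow> t < 1 \<Longrightarrow> t * measure (variation \<mu>) {0..<1 - t} \<le> C"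
begin

lemma C_nonneg: "0 \<le> C"
  using order_trans[OF _ mult_variation_le[of "1 / 2"]] by simp

lemma emeasure_mass_left: "0 < t \<Longrightarrow> emeasure (mass \<mu>) {0..<1 - t} < \<infinity>"
  by (rule emeasure_mass_finite[of _ "1 - t"]) auto

text \<open>The operator P. At t = 0 the factor t forces the value 0, whatever becomes of the
  integral over the possibly infinite mass of \<mu>.\<close>

definition deriv_transpose :: "(real \<Rightarrow> complex) \<Rightarrow> real \<Rightarrow> complex" where
  "deriv_transpose h t = of_real t * conv_transpose \<mu> h t"

lemma borel_measurable_deriv_transpose:
  "h \<in> borel_measurable borel \<Longrightarrow> deriv_transpose h \<in> borel_measurable borel"
  unfolding deriv_transpose_def using borel_measurable_conv_transpose[of h] by measurable

text \<open>The growth condition enters here: the inner integral is at most 2 B |\<mu>|([0,1 - t)),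
  and the factor t turns this into 2 B C.\<close>

lemma norm_deriv_transpose_le:
  assumes h: "h \<in> borel_measurable borel" "\<And>x. norm (h x) \<le> B"
  shows "norm (deriv_transpose h t) \<le> 2 * C * B"
proof (cases "0 < t \<and> t < 1")
  case True
  have B: "0 \<le> B" using order_trans[OF norm_ge_zero h(2)] .
  have "{0..<1 - t} \<inter> {0..<1} = {0..<1 - t}" using True by auto
  then have m: "measure (mass \<mu>) {0..<1 - t} = measure (variation \<mu>) {0..<1 - t}"
    by (simp add: measure_mass)
  have "norm (deriv_transpose h t) \<le> t * (2 * B * measure (variation \<mu>) {0..<1 - t})"
    unfolding deriv_transpose_def norm_mult m[symmetric] using True
    by (intro mult_mono norm_conv_transpose_le[OF h] emeasure_mass_left) auto
  also have "\<dots> = 2 * B * (t * measure (variation \<mu>) {0..<1 - t})" by simp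
  also have "\<dots> \<le> 2 * B * C"
    using True B by (intro mult_left_mono mult_variation_le) auto
  finally show ?thesis by (simp add: mult_ac)
next
  case False
  then have "deriv_transpose h t = 0"
    by (cases "t = 0") (auto simp: deriv_transpose_def conv_transpose_def)
  then show ?thesis
    using order_trans[OF norm_ge_zero h(2)] C_nonneg by simp
qed

lemma bounded_borel_deriv_transpose: "deriv_transpose h \<in> bounded_borel"
  if "h \<in> bounded_borel"
  using that
proof (elim bounded_borelE)
  fix B assume h: "h \<in> borel_measurable borel" "\<And>x. norm (h x) \<le> B"
  show ?thesis
    using borel_measurable_deriv_transpose[OF h(1)] norm_deriv_transpose_le[OF h] by (rule bounded_borelI)
qed

lemma deriv_transpose_add:
  assumes "f \<in> bounded_borel" "g \<in> bounded_borel"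
  shows "deriv_transpose (\<lambda>x. f x + g x) t = deriv_transpose f t + deriv_transpose g t"
proof (cases "0 < t")
  case True
  then show ?thesis
    using conv_transpose_add[OF assms emeasure_mass_left[OF True]] by (simp add: deriv_transpose_def distrib_left)
qed (cases "t = 0"; simp add: deriv_transpose_def conv_transpose_outside)

text \<open>The conditions on P are checked pointwise. For t > 0 the mass of
  \<open>{0..<1 - t}\<close> is finite and the facts on \<open>conv_transpose\<close> apply; for t
  <= 0 all values are 0.\<close>

lemma Dbar_functional:
  assumes "\<nu> \<in> finite_measures"
  shows "measure_functional (\<lambda>h. cint \<nu> {0..<1} (deriv_transpose h)) (2 * mnorm \<nu> * (2 * C))"
proof -
  interpret \<nu>: fin_measure \<nu> by unfold_locales fact
  show ?thesis
  proof (rule measure_functional_compose[OF \<nu>.measure_functional_cint])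
    fix h assume "h \<in> bounded_borel"
    then show "deriv_transpose h \<in> borel_measurable borel"
      by (intro borel_measurable_deriv_transpose bounded_borel_measurable)
  next
    fix f c t assume "f \<in> bounded_borel"
    then show "deriv_transpose (\<lambda>x. c * f x) t = c * deriv_transpose f t"
      by (simp add: deriv_transpose_def conv_transpose_scale)
  next
    fix f t assume "f \<in> bounded_borel"
    then show "deriv_transpose (\<lambda>x. indicator {0..<1} x * f x) t = deriv_transpose f t"
      by (simp add: deriv_transpose_def conv_transpose_local)
  next
    fix F :: "nat \<Rightarrow> real \<Rightarrow> complex" and f B t
    assume F: "\<And>n. F n \<in> borel_measurable borel" "\<And>n x. norm (F n x) \<le> B" "\<And>x. (\<lambda>n. F n x) \<longlonglongrightarrow> f x"
    show "(\<lambda>n. deriv_transpose (F n) t) \<longlonglongrightarrow> deriv_transpose f t"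
    proof (cases "0 < t")
      case True
      then show ?thesis
        unfolding deriv_transpose_def
        by (intro tendsto_mult tendsto_const conv_transpose_lim[OF F] emeasure_mass_left)
    qed (cases "t = 0"; simp add: deriv_transpose_def conv_transpose_outside)
  qed (auto intro: norm_deriv_transpose_le deriv_transpose_add simp: C_nonneg)
qed

text \<open>For h supported in \<open>{0..a}\<close> with a < 1,
  \<open>conv_transpose \<mu> h\<close> is itself a bounded test function, so the coordinate may be
  moved from the measure to the integrand, where it completes P h.\<close>

lemma Dbar_eq:
  assumes \<nu>: "\<nu> \<in> finite_measures"
  shows "Dbar \<mu> \<nu> = measure_of_functional (\<lambda>h. cint \<nu> {0..<1} (deriv_transpose h))"
  unfolding Dbar_def
proof (rule convolution_eq_measure_of_functional[OF Dbar_functional[OF \<nu>] _ locally_finite])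
  interpret \<nu>: fin_measure \<nu> by unfold_locales fact
  show "Xmult \<nu> \<in> locally_finite_measures"
    using Xmult_in_finite_measures[OF \<nu>] by (simp add: finite_measures_def)
  fix h and a :: real assume "0 \<le> a" and h: "h \<in> bounded_borel" "a < 1" "\<And>t. t \<notin> {0..a} \<Longrightarrow> h t = 0"
  show "cint (Xmult \<nu>) {0..<1} (conv_transpose \<mu> h) = cint \<nu> {0..<1} (deriv_transpose h)"
  proof (rule trans[OF cint_Xmult[OF \<nu> bounded_borel_conv_transpose_compact[OF h]]])
    show "cint \<nu> {0..<1} (\<lambda>x. indicator {0..<1} x * of_real x * conv_transpose \<mu> h x) =
        cint \<nu> {0..<1} (deriv_transpose h)"
      by (intro cint_cong \<nu>.locally_finite) (simp add: deriv_transpose_def)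
  qed
qed

text \<open>In \<open>4 * C\<close>, one factor 2 comes from the density of \<nu>, the other from
  that of \<mu>.\<close>

lemma Dbar_finite_measures:
  assumes \<nu>: "\<nu> \<in> finite_measures"
  shows Dbar_in_finite_measures: "Dbar \<mu> \<nu> \<in> finite_measures"
    and cint_Dbar: "h \<in> bounded_borel \<Longrightarrow> cint (Dbar \<mu> \<nu>) {0..<1} h = cint \<nu> {0..<1} (deriv_transpose h)"
    and mnorm_Dbar_le: "mnorm (Dbar \<mu> \<nu>) \<le> 4 * C * mnorm \<nu>"
proof -
  interpret L: measure_functional "\<lambda>h. cint \<nu> {0..<1} (deriv_transpose h)" "2 * mnorm \<nu> * (2 * C)"
    by (rule Dbar_functional[OF \<nu>])
  show "Dbar \<mu> \<nu> \<in> finite_measures"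
    "h \<in> bounded_borel \<Longrightarrow> cint (Dbar \<mu> \<nu>) {0..<1} h = cint \<nu> {0..<1} (deriv_transpose h)"
    "mnorm (Dbar \<mu> \<nu>) \<le> 4 * C * mnorm \<nu>"
    unfolding Dbar_eq[OF \<nu>] using L.measure_of_functional_finite L.cint_measure_of_functional L.mnorm_le
    by (simp_all add: mult_ac)
qed

text \<open>
  Transposed, the product rule is the identity \<open>(t + u) q(t + u) = t q(t + u) + u q(t + u)\<close>
  for \<open>q = conv_transpose \<mu> h\<close>.
\<close>

lemma cint_convolution_Dbar:
  assumes a: "a \<in> finite_measures" and b: "b \<in> finite_measures" and h: "h \<in> bounded_borel"
  shows "cint (convolution a (Dbar \<mu> b)) {0..<1} h =
    cint a {0..<1} (\<lambda>t. cint b {0..<1} (\<lambda>u. of_real u * conv_transpose \<mu> h (t + u)))"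
proof -
  interpret a: fin_measure a by unfold_locales fact
  interpret b: fin_measure b by unfold_locales fact
  interpret Db: fin_measure "Dbar \<mu> b" by unfold_locales (rule Dbar_in_finite_measures[OF b])
  have "conv_transpose (Dbar \<mu> b) h t = cint b {0..<1} (\<lambda>u. of_real u * conv_transpose \<mu> h (t + u))"
    if t: "t \<in> {0..<1}" for t
  proof -
    \<comment> \<open>The translate of h, cut off where t + x >= 1. Applying P to it produces the
      factor u alone, since the shift by t stays inside h.\<close>
    define k where "k x = indicator {0..<1 - t} x * h (t + x)" for x
    have k: "k \<in> bounded_borel"
    proof -
      obtain B where B: "h \<in> borel_measurable borel" "\<And>x. norm (h x) \<le> B"
        using h by (rule bounded_borelE) blast
      have "(\<lambda>x. h (t + x)) \<in> bounded_borel"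
      proof (rule bounded_borelI)
        show "(\<lambda>x. h (t + x)) \<in> borel_measurable borel"
          using measurable_compose[OF _ B(1), of "\<lambda>x. t + x" borel] by simp
      qed (rule B(2))
      then show ?thesis
        unfolding k_def by (intro bounded_borel_mult) auto
    qed
    have "conv_transpose (Dbar \<mu> b) h t = cint (Dbar \<mu> b) {0..<1} k"
      using t by (auto simp: conv_transpose_def k_def indicator_def intro!: cint_cong_indicator Db.locally_finite)
    also have "\<dots> = cint b {0..<1} (deriv_transpose k)"
      by (rule cint_Dbar[OF b k])
    also have "\<dots> = cint b {0..<1} (\<lambda>u. of_real u * conv_transpose \<mu> h (t + u))"
    proof (intro cint_cong b.locally_finite)
      fix u :: real assume u: "u \<in> {0..<1}"
      have "conv_transpose \<mu> k u = conv_transpose \<mu> h (t + u)"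
      \<comment> \<open>For t + u >= 1 both sides vanish: k is 0 from 1 - t on, and
        \<open>conv_transpose\<close> is 0 outside [0,1).\<close>
      proof (cases "t + u < 1")
        case True
        then have "cint \<mu> {0..<1 - u} (\<lambda>s. k (u + s)) = cint \<mu> {0..<1 - (t + u)} (\<lambda>s. h (t + u + s))"
          using t u by (intro cint_cong_indicator locally_finite) (auto simp: k_def indicator_def add_ac)
        then show ?thesis using True t u by (simp add: conv_transpose_def)
      next
        case False
        then have "cint \<mu> {0..<1 - u} (\<lambda>s. k (u + s)) = cint \<mu> {0..<1 - u} (\<lambda>_. 0)"
          using t u by (intro cint_cong locally_finite) (auto simp: k_def indicator_def)
        then show ?thesis using False u by (simp add: conv_transpose_def cint_def)
      qed
      then show "deriv_transpose k u = of_real u * conv_transpose \<mu> h (t + u)"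
        by (simp add: deriv_transpose_def)
    qed
    finally show ?thesis .
  qed
  then show ?thesis
    unfolding cint_convolution[OF a Dbar_in_finite_measures[OF b] h]
    by (intro cint_cong a.locally_finite)
qed

lemma Dbar_convolution:
  assumes a: "a \<in> finite_measures" and b: "b \<in> finite_measures"
  shows "Dbar \<mu> (convolution a b) = (\<lambda>A. convolution (Dbar \<mu> a) b A + convolution a (Dbar \<mu> b) A)"
proof (rule finite_measure_eqI)
  note fin = a b Dbar_in_finite_measures convolution_in_finite_measures
  show "Dbar \<mu> (convolution a b) \<in> finite_measures"
    "(\<lambda>A. convolution (Dbar \<mu> a) b A + convolution a (Dbar \<mu> b) A) \<in> finite_measures"
    by (intro fin add_finite_measures)+
  interpret a: fin_measure a by unfold_locales fact
  interpret b: fin_measure b by unfold_locales fact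
  interpret Ka: measure_functional "\<lambda>h. cint a {0..<1} h" "2 * mnorm a"
    by (rule a.measure_functional_cint)
  interpret Kb: measure_functional "\<lambda>h. cint b {0..<1} h" "2 * mnorm b"
    by (rule b.measure_functional_cint)
  fix h assume h: "h \<in> bounded_borel"
  then obtain B where B: "h \<in> borel_measurable borel" "\<And>x. norm (h x) \<le> B"
    by (rule bounded_borelE) blast
  define q where "q = conv_transpose \<mu> h"
  have [measurable]: "q \<in> borel_measurable borel"
    unfolding q_def using B(1) by (rule borel_measurable_conv_transpose)
  define F where "F t u = (if t \<in> {0..<1} \<and> u \<in> {0..<1} then of_real t * q (t + u) else 0)" for t u
  define G where "G t u = (if t \<in> {0..<1} \<and> u \<in> {0..<1} then of_real u * q (t + u) else 0)" for t u
  \<comment> \<open>q may be unbounded near 0. Each of t and u is at most t + u, so the estimate for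
    P at t + u bounds F and G separately, as exchanging and splitting the integrals
    requires.\<close>
  have q_le: "norm (of_real s * q (t + u)) \<le> 2 * C * B" if "0 \<le> s" "s \<le> t + u" for s t u :: real
  proof -
    have "norm (of_real s * q (t + u)) \<le> norm (of_real (t + u) * q (t + u))"
      unfolding norm_mult using that by (intro mult_right_mono) (simp_all del: of_real_add)
    also have "\<dots> \<le> 2 * C * B"
      using norm_deriv_transpose_le[OF B, of "t + u"] by (simp add: deriv_transpose_def q_def)
    finally show ?thesis .
  qed
  have CB: "0 \<le> 2 * C * B"
    using C_nonneg order_trans[OF norm_ge_zero B(2)] by simp
  have F: "case_prod F \<in> borel_measurable (borel \<Otimes>\<^sub>M borel)" "norm (F t u) \<le> 2 * C * B" for t u
    using q_le CB unfolding F_def by (measurable, auto)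
  have G: "case_prod G \<in> borel_measurable (borel \<Otimes>\<^sub>M borel)" "norm (G t u) \<le> 2 * C * B" for t u
    using q_le CB unfolding G_def by (measurable, auto)
  \<comment> \<open>Commutativity brings the derived factor to the right, the position treated by
    \<open>cint_convolution_Dbar\<close>; the integrals are exchanged afterwards.\<close>
  have "cint (convolution (Dbar \<mu> a) b) {0..<1} h = cint b {0..<1} (\<lambda>u. cint a {0..<1} (\<lambda>t. of_real t * q (u + t)))"
    unfolding q_def by (subst convolution_commute) (intro fin, intro fin, intro cint_convolution_Dbar a b h)
  also have "\<dots> = cint b {0..<1} (\<lambda>u. cint a {0..<1} (\<lambda>t. F t u))"
    by (intro cint_cong a.locally_finite b.locally_finite) (simp add: F_def add.commute)
  also have "\<dots> = cint a {0..<1} (\<lambda>t. cint b {0..<1} (F t))"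
    by (rule cint_swap[OF a b F, symmetric])
  finally have 1: "cint (convolution (Dbar \<mu> a) b) {0..<1} h = cint a {0..<1} (\<lambda>t. cint b {0..<1} (F t))" .
  have 2: "cint (convolution a (Dbar \<mu> b)) {0..<1} h = cint a {0..<1} (\<lambda>t. cint b {0..<1} (G t))"
    unfolding cint_convolution_Dbar[OF a b h]
    by (intro cint_cong a.locally_finite b.locally_finite) (simp add: G_def q_def)
  have "cint (Dbar \<mu> (convolution a b)) {0..<1} h = cint a {0..<1} (conv_transpose b (deriv_transpose h))"
    by (simp add: cint_Dbar fin h cint_convolution bounded_borel_deriv_transpose)
  also have "\<dots> = cint a {0..<1} (\<lambda>t. cint b {0..<1} (F t) + cint b {0..<1} (G t))"
  proof (intro cint_cong a.locally_finite)
    fix t :: real assume t: "t \<in> {0..<1}"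
    have "conv_transpose b (deriv_transpose h) t = cint b {0..<1} (\<lambda>u. F t u + G t u)"
      unfolding conv_transpose_def if_P[OF t]
    proof (rule cint_cong_indicator[OF _ b.locally_finite])
      fix u :: real assume "u \<in> {0..<1}"
      then show "indicator {0..<1 - t} u *\<^sub>R deriv_transpose h (t + u) = indicator {0..<1} u *\<^sub>R (F t u + G t u)"
        using t conv_transpose_outside[of "t + u" \<mu> h]
        by (auto simp: F_def G_def deriv_transpose_def q_def indicator_def distrib_right)
    qed
    also have "\<dots> = cint b {0..<1} (F t) + cint b {0..<1} (G t)"
      by (rule Kb.add[OF bounded_borel_cint(2)[OF b F] bounded_borel_cint(2)[OF b G]])
    finally show "conv_transpose b (deriv_transpose h) t = cint b {0..<1} (F t) + cint b {0..<1} (G t)" .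
  qed
  also have "\<dots> = cint a {0..<1} (\<lambda>t. cint b {0..<1} (F t)) + cint a {0..<1} (\<lambda>t. cint b {0..<1} (G t))"
    by (rule Ka.add[OF bounded_borel_cint(1)[OF b F] bounded_borel_cint(1)[OF b G]])
  also have "\<dots> = cint (\<lambda>A. convolution (Dbar \<mu> a) b A + convolution a (Dbar \<mu> b) A) {0..<1} h"
    unfolding 1[symmetric] 2[symmetric] by (intro add_finite_measures(2)[symmetric] fin h)
  finally show "cint (Dbar \<mu> (convolution a b)) {0..<1} h =
      cint (\<lambda>A. convolution (Dbar \<mu> a) b A + convolution a (Dbar \<mu> b) A) {0..<1} h" .
qed

lemma Dbar_add:
  assumes a: "a \<in> finite_measures" and b: "b \<in> finite_measures"
  shows "Dbar \<mu> (\<lambda>A. a A + b A) = (\<lambda>A. Dbar \<mu> a A + Dbar \<mu> b A)"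
  by (rule finite_measure_eqI)
    (simp_all add: add_finite_measures a b Dbar_finite_measures bounded_borel_deriv_transpose)

lemma Dbar_scale:
  assumes a: "a \<in> finite_measures"
  shows "Dbar \<mu> (\<lambda>A. c * a A) = (\<lambda>A. c * Dbar \<mu> a A)"
  by (rule finite_measure_eqI)
    (simp_all add: scale_finite_measures a Dbar_finite_measures bounded_borel_deriv_transpose)

lemma derivation_on_M_Dbar: "derivation_on_M (Dbar \<mu>)"
  unfolding derivation_on_M_def
  by (intro conjI ballI allI Dbar_in_finite_measures Dbar_add Dbar_scale Dbar_convolution)

lemma bounded_on_M_Dbar: "bounded_on_M (Dbar \<mu>)"
  unfolding bounded_on_M_def using mnorm_Dbar_le by blast

end

section \<open>Weak-star continuity\<close>

lemma C0_bounded_borel: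
  assumes "h \<in> C0"
  shows "(\<lambda>x. indicator {0..<1} x * h x) \<in> bounded_borel"
proof -
  have cont: "continuous_on {0..1} h" using assms by (simp add: C0_def)
  then have "bounded (h ` {0..1})"
    by (intro compact_imp_bounded compact_continuous_image) auto
  then obtain B where B: "\<And>x. x \<in> {0..1} \<Longrightarrow> norm (h x) \<le> B"
    unfolding bounded_iff by blast
  have "(\<lambda>x. indicator {0..<1} x *\<^sub>R h x) \<in> borel_measurable borel"
    by (intro borel_measurable_continuous_on_indicator continuous_on_subset[OF cont]) auto
  then have "(\<lambda>x. indicator {0..<1} x * h x) \<in> borel_measurable borel"
    by (simp add: scaleR_conv_of_real of_real_indicator)
  moreover have "norm (indicator {0..<1} x * h x) \<le> max 0 B" for x
    using B[of x] by (auto simp: indicator_def)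
  ultimately show ?thesis by (rule bounded_borelI)
qed

text \<open>Translates reach beyond 1, so h is extended by 0; the pieces fit because
  \<open>h 1 = 0\<close>. The domain starts at 0, where the extension may jump from the
  left.\<close>

lemma C0_extend_continuous:
  assumes "h \<in> C0"
  shows "continuous_on {0..} (\<lambda>x. indicator {0..<1} x * h x)"
proof -
  have "continuous_on ({0..1} \<union> {1..}) (\<lambda>x. if x \<in> {0..1} then h x else 0)"
    using assms by (intro continuous_on_If) (auto simp: C0_def)
  moreover have "{0..1} \<union> {1..} = {0::real..}" by auto
  ultimately have "continuous_on {0..} (\<lambda>x. if x \<in> {0..1} then h x else 0)" by simp
  then show ?thesis
  proof (rule continuous_on_eq)
    fix x :: real assume "x \<in> {0..}"
    then show "(if x \<in> {0..1} then h x else 0) = indicator {0..<1} x * h x"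
      using assms by (cases "x = 1") (auto simp: C0_def indicator_def)
  qed
qed

context volterra_measure
begin

text \<open>Boundedness of P alone gives no limit at 0. Split h at a point a near 1: the part up to
  a has an inner integral bounded by some K, and t K tends to 0; the part beyond a has small sup
  norm, so P makes it small uniformly in t.\<close>

lemma deriv_transpose_tendsto_0:
  assumes h: "h \<in> bounded_borel" and lim: "((\<lambda>x. h x) \<longlongrightarrow> 0) (at_left 1)"
    and supp: "\<And>x. x \<notin> {0..<1} \<Longrightarrow> h x = 0"
  shows "(deriv_transpose h \<longlongrightarrow> 0) (at_right 0)"
proof (rule tendstoI)
  fix e :: real assume "0 < e"
  \<comment> \<open>Chosen so that \<open>2 * C * d < e / 2\<close>; the added 1 covers C =
    0.\<close>
  define d where "d = e / (2 * (2 * C + 1))"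
  have d: "0 < d" "2 * C * d < e / 2"
    using \<open>0 < e\<close> C_nonneg by (auto simp: d_def field_simps)
  obtain a where a: "a < 1" "\<And>x. a < x \<Longrightarrow> x < 1 \<Longrightarrow> norm (h x) < d"
    using tendstoD[OF lim d(1)] by (auto simp: eventually_at_left_field dist_norm)
  define f where "f x = indicator {..a} x * h x" for x
  define g where "g x = indicator {a<..} x * h x" for x
  have f: "f \<in> bounded_borel" and g: "g \<in> bounded_borel"
    unfolding f_def g_def using h by (auto intro!: bounded_borel_mult)
  have "conv_transpose \<mu> f \<in> bounded_borel"
    by (rule bounded_borel_conv_transpose_compact[OF f a(1)]) (use supp in \<open>auto simp: f_def indicator_def\<close>)
  then obtain K where K: "\<And>t. norm (conv_transpose \<mu> f t) \<le> K"
    by (rule bounded_borelE) blast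
  have "0 \<le> K" using order_trans[OF norm_ge_zero K] .
  \<comment> \<open>The threshold gives \<open>t * (K + 1) < e / 2\<close>; the added 1 keeps the
    denominator positive when K = 0.\<close>
  have small: "norm (deriv_transpose h t) < e" if "0 < t" "t < e / (2 * (K + 1))" for t
  proof -
    have "deriv_transpose h t = deriv_transpose f t + deriv_transpose g t"
      unfolding deriv_transpose_add[OF f g, symmetric]
      by (rule arg_cong[of _ _ "\<lambda>h. deriv_transpose h t"]) (auto simp: f_def g_def indicator_def)
    moreover have "norm (deriv_transpose f t) \<le> t * K"
      unfolding deriv_transpose_def norm_mult using that K by (intro mult_mono) auto
    moreover have "t * K \<le> t * (K + 1)"
      using that by (intro mult_left_mono) auto
    moreover have "t * (K + 1) < e / 2"
      using that \<open>0 \<le> K\<close> by (simp add: field_simps)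
    moreover have "norm (deriv_transpose g t) \<le> 2 * C * d"
    proof (rule norm_deriv_transpose_le)
      show "norm (g x) \<le> d" for x
        using a(2)[of x] supp[of x] d(1) by (cases "x \<in> {0..<1}") (auto simp: g_def indicator_def)
    qed (use g in \<open>rule bounded_borel_measurable\<close>)
    ultimately show ?thesis
      using norm_triangle_ineq[of "deriv_transpose f t" "deriv_transpose g t"] d(2) by simp
  qed
  have "0 < e / (2 * (K + 1))"
    using \<open>0 < e\<close> \<open>0 \<le> K\<close> by simp
  then show "eventually (\<lambda>t. dist (deriv_transpose h t) 0 < e) (at_right 0)"
    using small by (auto simp: eventually_at_right_field)
qed

text \<open>For t > 0 continuity is dominated convergence on an interval of finite mass; at t = 0 it
  is \<open>deriv_transpose_tendsto_0\<close>, applicable because h vanishes at 1.\<close>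

lemma deriv_transpose_C0:
  assumes "h \<in> C0"
  shows "deriv_transpose (\<lambda>x. indicator {0..<1} x * h x) \<in> C0"
proof -
  define k where "k x = indicator {0..<1} x * h x" for x
  have k: "k \<in> bounded_borel" and cont: "continuous_on {0..} k"
    unfolding k_def using C0_bounded_borel[OF assms] C0_extend_continuous[OF assms] by simp_all
  from k obtain B where B: "k \<in> borel_measurable borel" "\<And>x. norm (k x) \<le> B"
    by (rule bounded_borelE) blast
  note [measurable] = B(1)
  have k0: "k x = 0" if "x \<notin> {0..<1}" for x
    using that by (simp add: k_def)
  have zero: "deriv_transpose k 0 = 0" "deriv_transpose k 1 = 0"
    by (simp_all add: deriv_transpose_def conv_transpose_outside)
  text \<open>Since \<open>k\<close> vanishes on \<open>[1,\<infinity>)\<close>, the domain of integration need not depend on \<open>t\<close>.\<close>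
  have eq: "conv_transpose \<mu> k t = (\<integral>s. indicator {0..} s *\<^sub>R (k (t + s) * dens \<mu> s) \<partial>mass \<mu>)"
    if t: "0 \<le> t" "t \<le> 1" for t
  proof (cases "t = 1")
    case True
    have "(\<integral>s. indicator {0..} s *\<^sub>R (k (t + s) * dens \<mu> s) \<partial>mass \<mu>) = (\<integral>s. 0 \<partial>mass \<mu>)"
      using True k0 by (intro Bochner_Integration.integral_cong) (auto simp: indicator_def)
    then show ?thesis using True by (simp add: conv_transpose_outside)
  next
    case False
    then show ?thesis
      using t k0 by (subst conv_transpose_eq[OF B(1)])
        (auto simp: indicator_def intro!: Bochner_Integration.integral_cong)
  qed
  \<comment> \<open>Arguments at least t / 2 make \<open>k (X n + s)\<close> vanish for s >= 1 - t /
    2, so one interval of finite mass carries all the integrands.\<close>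
  have seq_pos: "(\<lambda>n. deriv_transpose k (X n)) \<longlonglongrightarrow> deriv_transpose k t"
    if X: "X \<longlonglongrightarrow> t" "\<And>n. X n \<in> {t / 2..1}" and t: "0 < t" "t \<le> 1" for X :: "nat \<Rightarrow> real" and t
  proof -
    have X0: "0 \<le> X n" "X n \<le> 1" "t / 2 \<le> X n" for n
      using X(2)[of n] t by auto
    have "(\<lambda>n. \<integral>s. indicator {0..} s *\<^sub>R (k (X n + s) * dens \<mu> s) \<partial>mass \<mu>)
        \<longlonglongrightarrow> (\<integral>s. indicator {0..} s *\<^sub>R (k (t + s) * dens \<mu> s) \<partial>mass \<mu>)"
    proof (rule integral_dominated_convergence[where w = "\<lambda>s. 2 * B * indicator {0..<1 - t / 2} s"])
      show "integrable (mass \<mu>) (\<lambda>s. 2 * B * indicator {0..<1 - t / 2} s :: real)"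
        using emeasure_mass_left[of "t / 2"] t by (simp add: integrable_indicator_iff)
      show "AE s in mass \<mu>. norm (indicator {0..} s *\<^sub>R (k (X n + s) * dens \<mu> s)) \<le>
          2 * B * indicator {0..<1 - t / 2} s" for n
      proof (rule AE_I2)
        fix s
        have "norm (k (X n + s) * dens \<mu> s) \<le> B * 2"
          unfolding norm_mult using order_trans[OF norm_ge_zero B(2)]
          by (intro mult_mono B norm_dens_le) auto
        then show "norm (indicator {0..} s *\<^sub>R (k (X n + s) * dens \<mu> s)) \<le>
            2 * B * indicator {0..<1 - t / 2} s"
          using X0(3)[of n] k0[of "X n + s"] by (auto simp: indicator_def)
      qed
      have "(\<lambda>n. k (X n + s)) \<longlonglongrightarrow> k (t + s)" if "0 \<le> s" for s
      proof (rule continuous_on_tendsto_compose[OF cont])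
        show "(\<lambda>n. X n + s) \<longlonglongrightarrow> t + s"
          by (intro tendsto_intros X(1))
      qed (use that t X0(1) in auto)
      then show "AE s in mass \<mu>. (\<lambda>n. indicator {0..} s *\<^sub>R (k (X n + s) * dens \<mu> s))
          \<longlonglongrightarrow> indicator {0..} s *\<^sub>R (k (t + s) * dens \<mu> s)"
        by (intro AE_I2) (auto simp: indicator_def intro!: tendsto_mult tendsto_const)
    qed simp_all
    from tendsto_mult[OF tendsto_of_real[OF X(1)] this] show ?thesis
      unfolding deriv_transpose_def eq[OF X0(1,2)] eq[OF less_imp_le[OF t(1)] t(2)] .
  qed
  have "continuous_on {0..1} (deriv_transpose k)"
    unfolding continuous_on_sequentially comp_def
  proof (intro allI impI ballI)
    fix X :: "nat \<Rightarrow> real" and t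
    assume "t \<in> {0..1}" and "(\<forall>n. X n \<in> {0..1}) \<and> X \<longlonglongrightarrow> t"
    then have t: "0 \<le> t" "t \<le> 1" and X: "\<And>n. 0 \<le> X n" "\<And>n. X n \<le> 1" "X \<longlonglongrightarrow> t"
      by auto
    show "(\<lambda>n. deriv_transpose k (X n)) \<longlonglongrightarrow> deriv_transpose k t"
    proof (cases "t = 0")
      case True
      have "(k \<longlongrightarrow> 0) (at_left 1)"
      proof -
        have "(k \<longlongrightarrow> k 1) (at 1 within {0..})"
          using cont by (simp add: continuous_on_def)
        then have "(k \<longlongrightarrow> k 1) (at 1 within {0..<1})"
          by (rule tendsto_within_subset) auto
        moreover have "at 1 within {0..<1} = at_left (1::real)"
          by (rule at_within_nhd[of _ "{0<..}"]) auto
        ultimately show ?thesis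
          using k0[of 1] by simp
      qed
      from deriv_transpose_tendsto_0[OF k this k0]
      have "((\<lambda>t. deriv_transpose k t) \<longlongrightarrow> deriv_transpose k 0) (at 0 within {0..})"
        by (simp add: zero at_within_Ici_at_right)
      then have "continuous (at 0 within {0..}) (deriv_transpose k)"
        by (simp add: continuous_within)
      then show ?thesis
        using X True unfolding continuous_within_sequentially comp_def by auto
    next
      case False
      then have "0 < t" using t by simp
      \<comment> \<open>The sequence is pushed up to t / 2 to fit \<open>seq_pos\<close>; eventually
        this changes nothing, as its limit t exceeds t / 2.\<close>
      have "(\<lambda>n. max (X n) (t / 2)) \<longlonglongrightarrow> max t (t / 2)"
        by (intro tendsto_intros X)
      then have "(\<lambda>n. deriv_transpose k (max (X n) (t / 2))) \<longlonglongrightarrow> deriv_transpose k t"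
        using X(2) \<open>0 < t\<close> t(2) by (intro seq_pos) auto
      moreover have "eventually (\<lambda>n. X n > t / 2) sequentially"
        using X(3) \<open>0 < t\<close> by (intro order_tendstoD(1)) auto
      then have "eventually (\<lambda>n. deriv_transpose k (max (X n) (t / 2)) = deriv_transpose k (X n)) sequentially"
        by eventually_elim (simp add: max_def)
      ultimately show ?thesis
        by (rule Lim_transform_eventually)
    qed
  qed
  then show ?thesis
    using zero unfolding C0_def k_def[abs_def] by simp
qed

text \<open>The choice h = 0, U = UNIV makes the whole of M[0,1) a subbasic set.\<close>

lemma topspace_weak_star: "topspace weak_star = finite_measures"
proof -
  have "(\<lambda>_. 0) \<in> C0" by (simp add: C0_def)
  then have "finite_measures \<in> {{\<nu> \<in> finite_measures. cint \<nu> {0..<1} h \<in> U} | h U. h \<in> C0 \<and> open U}"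
    by (intro CollectI exI[of _ "\<lambda>_. 0"] exI[of _ UNIV]) simp
  then show ?thesis
    unfolding weak_star_def topology_generated_by_topspace by blast
qed

text \<open>The preimage of the subbasic set of h and U is the subbasic set of P h and U, with h
  first set to 0 outside [0,1); \<open>deriv_transpose_C0\<close> makes P h an admissible
  test.\<close>

lemma continuous_map_Dbar: "continuous_map weak_star weak_star (Dbar \<mu>)"
proof -
  let ?S = "{{\<nu> \<in> finite_measures. cint \<nu> {0..<1} h \<in> U} | h U. h \<in> C0 \<and> open U}"
  have "continuous_map weak_star (topology_generated_by ?S) (Dbar \<mu>)"
  proof (rule continuous_on_generated_topo)
    fix V assume "V \<in> ?S"
    then obtain h U where V: "V = {\<nu> \<in> finite_measures. cint \<nu> {0..<1} h \<in> U}" "h \<in> C0" "open U"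
      by blast
    define k where "k = deriv_transpose (\<lambda>x. indicator {0..<1} x * h x)"
    have "cint (Dbar \<mu> \<nu>) {0..<1} h = cint \<nu> {0..<1} k" if \<nu>: "\<nu> \<in> finite_measures" for \<nu>
    proof -
      have "Dbar \<mu> \<nu> \<in> locally_finite_measures"
        using Dbar_in_finite_measures[OF \<nu>] by (simp add: finite_measures_def)
      then have "cint (Dbar \<mu> \<nu>) {0..<1} h = cint (Dbar \<mu> \<nu>) {0..<1} (\<lambda>x. indicator {0..<1} x * h x)"
        by (intro cint_cong) simp_all
      then show ?thesis
        by (simp add: cint_Dbar[OF \<nu> C0_bounded_borel[OF V(2)]] k_def)
    qed
    then have "Dbar \<mu> -` V \<inter> topspace weak_star = {\<nu> \<in> finite_measures. cint \<nu> {0..<1} k \<in> U}"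
      using Dbar_in_finite_measures by (auto simp: V(1) topspace_weak_star)
    moreover have "k \<in> C0"
      unfolding k_def by (rule deriv_transpose_C0[OF V(2)])
    then have "{\<nu> \<in> finite_measures. cint \<nu> {0..<1} k \<in> U} \<in> ?S"
      using V(3) by blast
    then have "openin weak_star {\<nu> \<in> finite_measures. cint \<nu> {0..<1} k \<in> U}"
      unfolding weak_star_def by (rule topology_generated_by_Basis)
    ultimately show "openin weak_star (Dbar \<mu> -` V \<inter> topspace weak_star)" by simp
  next
    have "\<Union> ?S = finite_measures"
      using topspace_weak_star unfolding weak_star_def topology_generated_by_topspace .
    then show "Dbar \<mu> ` topspace weak_star \<subseteq> \<Union> ?S"
      using Dbar_in_finite_measures by (auto simp: topspace_weak_star)
  qed
  then show ?thesis
    by (simp add: weak_star_def)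
qed

end

section \<open>Integrable functions\<close>

text \<open>\<open>cint\<close> refers to the chosen polar density of f(t) dt, which is not
  explicit; the functional with density g, f extended by 0, gives the integrals directly.\<close>

lemma L1_measure_finite_measures:
  assumes "f \<in> L1"
  defines "g \<equiv> \<lambda>t. indicator {0..<1} t *\<^sub>R f t"
  shows L1_measure_in_finite_measures: "L1_measure f \<in> finite_measures"
    and cint_L1_measure: "h \<in> bounded_borel \<Longrightarrow> cint (L1_measure f) {0..<1} h = (\<integral>t. h t * g t \<partial>lborel)"
proof -
  have g: "integrable lborel g"
    using assms(1) by (simp add: L1_def set_integrable_def g_def)
  interpret L: measure_functional "\<lambda>h. \<integral>t. h t * g t \<partial>lborel" "\<integral>t. norm (g t) \<partial>lborel"
    by (rule measure_functional_integral[OF g]) (auto simp: g_def)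
  have "L1_measure f = measure_of_functional (\<lambda>h. \<integral>t. h t * g t \<partial>lborel)"
    by (auto simp: fun_eq_iff L1_measure_def measure_of_functional_def set_lebesgue_integral_def g_def borel01_iff
        indicator_def intro!: Bochner_Integration.integral_cong)
  then show "L1_measure f \<in> finite_measures"
    "h \<in> bounded_borel \<Longrightarrow> cint (L1_measure f) {0..<1} h = (\<integral>t. h t * g t \<partial>lborel)"
    using L.measure_of_functional_finite L.cint_measure_of_functional by simp_all
qed

lemma integrable_mult_bounded:
  fixes v w :: "'a \<Rightarrow> complex"
  assumes w: "integrable M w" and v: "v \<in> borel_measurable M" "\<And>x. norm (v x) \<le> B"
  shows "integrable M (\<lambda>x. v x * w x)"
proof (rule Bochner_Integration.integrable_bound)
  show "integrable M (\<lambda>x. B * norm (w x))"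
    using w by simp
  show "(\<lambda>x. v x * w x) \<in> borel_measurable M"
    using v(1) borel_measurable_integrable[OF w] by measurable
  have "norm (v x * w x) \<le> B * norm (w x)" for x
    unfolding norm_mult by (intro mult_right_mono v(2)) simp
  then show "AE x in M. norm (v x * w x) \<le> norm (B * norm (w x))"
    by (intro AE_I2) (rule order_trans, assumption, simp)
qed

context volterra_measure
begin

text \<open>As \<mu> may be infinite, absolute convergence is the issue: for fixed x the integral of
  |K x s| is at most 2 C |g x| by the growth condition, and this is integrable in x. Fubini and the
  translation t = x + s then match the integrals of h against both measures.\<close>

lemma D_L1:
  assumes f: "f \<in> L1"
  shows D_L1_in_L1: "D_L1 \<mu> f \<in> L1"
    and Dbar_L1_measure: "Dbar \<mu> (L1_measure f) = L1_measure (D_L1 \<mu> f)"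
proof -
  define g where "g t = indicator {0..<1} t *\<^sub>R f t" for t
  have g: "integrable lborel g"
    using f by (simp add: L1_def set_integrable_def g_def[abs_def])
  have [measurable]: "g \<in> borel_measurable borel"
    using borel_measurable_integrable[OF g] by simp
  \<comment> \<open>The integrand of Xf * \<mu> in the variables x = t - s and s; the condition x +
    s < 1 is the truncation to [0,1).\<close>
  define K where "K x s = (if 0 \<le> x \<and> 0 \<le> s \<and> x + s < 1 then of_real x * g x * dens \<mu> s else 0)" for x s
  have K_meas[measurable]: "case_prod K \<in> borel_measurable (borel \<Otimes>\<^sub>M borel)"
    unfolding K_def by measurable
  have sets_pair: "sets (lborel \<Otimes>\<^sub>M mass \<mu>) = sets (borel \<Otimes>\<^sub>M (borel :: real measure))"
    by (intro sets_pair_measure_cong) simp_all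
  have meas: "u \<in> borel_measurable (lborel \<Otimes>\<^sub>M mass \<mu>)" if "u \<in> borel_measurable (borel \<Otimes>\<^sub>M borel)"
    for u :: "real \<times> real \<Rightarrow> 'b::topological_space"
    using that by (simp only: measurable_cong_sets[OF sets_pair refl])
  interpret pair_sigma_finite lborel "mass \<mu>" ..
  have K_bound: "(\<integral>\<^sup>+s. ennreal (norm (K x s)) \<partial>mass \<mu>) \<le> ennreal (2 * C * norm (g x))" for x
  proof (cases "0 < x \<and> x < 1")
    case True
    have "(\<integral>\<^sup>+s. ennreal (norm (K x s)) \<partial>mass \<mu>) \<le>
        (\<integral>\<^sup>+s. ennreal (2 * x * norm (g x)) * indicator {0..<1 - x} s \<partial>mass \<mu>)"
    proof (rule nn_integral_mono)
      fix s
      have "norm (of_real x * g x * dens \<mu> s) \<le> x * norm (g x) * 2"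
        unfolding norm_mult using True by (intro mult_mono norm_dens_le) auto
      then show "ennreal (norm (K x s)) \<le> ennreal (2 * x * norm (g x)) * indicator {0..<1 - x} s"
        by (auto simp: K_def indicator_def mult_ac intro!: ennreal_leI)
    qed
    also have "\<dots> = ennreal (2 * x * norm (g x)) * emeasure (mass \<mu>) {0..<1 - x}"
      by (rule nn_integral_cmult_indicator) simp
    also have "emeasure (mass \<mu>) {0..<1 - x} = ennreal (measure (mass \<mu>) {0..<1 - x})"
      using emeasure_mass_left[of x] True by (intro emeasure_eq_ennreal_measure) auto
    also have "measure (mass \<mu>) {0..<1 - x} = measure (variation \<mu>) {0..<1 - x}"
    proof -
      have "{0..<1 - x} \<inter> {0..<1} = {0..<1 - x}" using True by auto
      then show ?thesis by (simp add: measure_mass)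
    qed
    also have "ennreal (2 * x * norm (g x)) * ennreal (measure (variation \<mu>) {0..<1 - x}) =
        ennreal (2 * norm (g x) * (x * measure (variation \<mu>) {0..<1 - x}))"
      using True by (simp add: ennreal_mult[symmetric] mult_ac)
    also have "\<dots> \<le> ennreal (2 * norm (g x) * C)"
      using True by (intro ennreal_leI mult_left_mono mult_variation_le) auto
    finally show ?thesis by (simp add: mult_ac)
  next
    case False
    then have "K x s = 0" for s
      by (cases "x = 0") (auto simp: K_def)
    then show ?thesis by simp
  qed
  have K_fin: "(\<integral>\<^sup>+x. \<integral>\<^sup>+s. ennreal (norm (K x s)) \<partial>mass \<mu> \<partial>lborel) < \<infinity>"
  proof -
    have "(\<integral>\<^sup>+x. \<integral>\<^sup>+s. ennreal (norm (K x s)) \<partial>mass \<mu> \<partial>lborel) \<le> (\<integral>\<^sup>+x. ennreal (2 * C * norm (g x)) \<partial>lborel)"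
      by (intro nn_integral_mono K_bound)
    also have "\<dots> = ennreal (2 * C) * (\<integral>\<^sup>+x. ennreal (norm (g x)) \<partial>lborel)"
      using C_nonneg by (subst nn_integral_cmult[symmetric]) (auto simp: ennreal_mult)
    also have "\<dots> < \<infinity>"
      using g by (simp add: integrable_iff_bounded ennreal_mult_less_top)
    finally show ?thesis .
  qed
  have K_int: "integrable (lborel \<Otimes>\<^sub>M mass \<mu>) (\<lambda>(x, s). u (x + s) * K x s)"
    if "u \<in> bounded_borel" for u
  proof -
    obtain B where B: "u \<in> borel_measurable borel" "\<And>x. norm (u x) \<le> B"
      using \<open>u \<in> bounded_borel\<close> by (rule bounded_borelE) blast
    note [measurable] = B(1)
    have "integrable (lborel \<Otimes>\<^sub>M mass \<mu>) (case_prod K)"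
    proof (rule integrableI_bounded)
      show "case_prod K \<in> borel_measurable (lborel \<Otimes>\<^sub>M mass \<mu>)"
        by (rule meas[OF K_meas])
      have "(\<lambda>(x, s). ennreal (norm (K x s))) \<in> borel_measurable (lborel \<Otimes>\<^sub>M mass \<mu>)"
        by (rule meas) measurable
      from mass.nn_integral_fst[OF this] K_fin
      show "(\<integral>\<^sup>+p. ennreal (norm (case_prod K p)) \<partial>(lborel \<Otimes>\<^sub>M mass \<mu>)) < \<infinity>"
        by (simp add: case_prod_unfold)
    qed
    moreover have "(\<lambda>(x, s). u (x + s)) \<in> borel_measurable (lborel \<Otimes>\<^sub>M mass \<mu>)"
      by (rule meas) measurable
    ultimately show ?thesis
      using integrable_mult_bounded[of _ "case_prod K" "\<lambda>(x, s). u (x + s)" B] B(2)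
      by (simp add: case_prod_unfold)
  qed
  text \<open>Passing from \<open>K x s\<close> to \<open>K (t - s) s\<close> is the substitution \<open>t = x + s\<close> for fixed \<open>s\<close>.\<close>
  have Kt_meas[measurable]: "(\<lambda>(t, s). K (t - s) s) \<in> borel_measurable (borel \<Otimes>\<^sub>M borel)"
    unfolding K_def by measurable
  have shift_nn: "(\<integral>\<^sup>+t. v (t - s) \<partial>lborel) = (\<integral>\<^sup>+x. v x \<partial>lborel)"
    if [measurable]: "v \<in> borel_measurable borel" for v :: "real \<Rightarrow> ennreal" and s
    using nn_integral_real_affine[of v 1 "- s"] by simp
  have shift: "(\<integral>t. v t \<partial>lborel) = (\<integral>x. v (x + s) \<partial>lborel)"
    for v :: "real \<Rightarrow> complex" and s
    using lborel_integral_real_affine[of 1 v s] by (simp add: add.commute)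
  \<comment> \<open>With s fixed, translation invariance in t gives the same integral as for K, so
    \<open>K_fin\<close> bounds this one as well.\<close>
  have Kt_int: "integrable (lborel \<Otimes>\<^sub>M mass \<mu>) (\<lambda>(t, s). u t * K (t - s) s)"
    if u: "u \<in> bounded_borel" for u
  proof -
    obtain B where B: "u \<in> borel_measurable borel" "\<And>x. norm (u x) \<le> B"
      using u by (rule bounded_borelE) blast
    note [measurable] = B(1)
    have "integrable (lborel \<Otimes>\<^sub>M mass \<mu>) (\<lambda>(t, s). K (t - s) s)"
    proof (rule integrableI_bounded)
      show "(\<lambda>(t, s). K (t - s) s) \<in> borel_measurable (lborel \<Otimes>\<^sub>M mass \<mu>)"
        by (rule meas) measurable
      have m: "(\<lambda>(t, s). ennreal (norm (K (t - s) s))) \<in> borel_measurable (lborel \<Otimes>\<^sub>M mass \<mu>)"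
        by (rule meas) measurable
      have m': "(\<lambda>(x, s). ennreal (norm (K x s))) \<in> borel_measurable (lborel \<Otimes>\<^sub>M mass \<mu>)"
        by (rule meas) measurable
      have K1: "(\<lambda>x. K x s) \<in> borel_measurable borel" for s
        unfolding K_def by measurable
      have "(\<integral>\<^sup>+p. ennreal (norm (case p of (t, s) \<Rightarrow> K (t - s) s)) \<partial>(lborel \<Otimes>\<^sub>M mass \<mu>)) =
          (\<integral>\<^sup>+s. \<integral>\<^sup>+t. ennreal (norm (K (t - s) s)) \<partial>lborel \<partial>mass \<mu>)"
        using nn_integral_snd[OF m] by (simp add: case_prod_unfold)
      also have "\<dots> = (\<integral>\<^sup>+s. \<integral>\<^sup>+x. ennreal (norm (K x s)) \<partial>lborel \<partial>mass \<mu>)"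
        using K1 by (intro nn_integral_cong shift_nn) measurable
      also have "\<dots> = (\<integral>\<^sup>+x. \<integral>\<^sup>+s. ennreal (norm (K x s)) \<partial>mass \<mu> \<partial>lborel)"
        using Fubini'[OF m'] by simp
      also note K_fin
      finally show "(\<integral>\<^sup>+p. ennreal (norm (case p of (t, s) \<Rightarrow> K (t - s) s)) \<partial>(lborel \<Otimes>\<^sub>M mass \<mu>)) < \<infinity>" .
    qed
    moreover have "(\<lambda>(t, s). u t) \<in> borel_measurable (lborel \<Otimes>\<^sub>M mass \<mu>)"
      by (rule meas) measurable
    ultimately show ?thesis
      using integrable_mult_bounded[of _ "\<lambda>(t, s). K (t - s) s" "\<lambda>(t, s). u t" B] B(2)
      by (simp add: case_prod_unfold)
  qed
  define G where "G t = (\<integral>s. K (t - s) s \<partial>mass \<mu>)" for t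
  have G_int: "integrable lborel G"
    using integrable_fst[OF Kt_int[OF bounded_borel_const[of 1]]] by (simp add: G_def[abs_def])
  \<comment> \<open>Equality holds at every t: where the integral diverges, both sides take the
    default value 0 of the Bochner integral.\<close>
  have D_eq: "indicator {0..<1} t *\<^sub>R D_L1 \<mu> f t = G t" for t
  proof (cases "t \<in> {0..<1}")
    case True
    have "D_L1 \<mu> f t = cint \<mu> {0..t} (\<lambda>s. of_real (t - s) * g (t - s))"
      unfolding D_L1_def using True by (intro cint_cong locally_finite) (auto simp: g_def)
    also have "\<dots> = (\<integral>s. indicator {0..t} s *\<^sub>R (of_real (t - s) * g (t - s) * dens \<mu> s) \<partial>mass \<mu>)"
      by (rule cint_eq) measurable
    also have "\<dots> = G t"
      unfolding G_def using True by (intro Bochner_Integration.integral_cong) (auto simp: K_def indicator_def)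
    finally show ?thesis using True by simp
  next
    case False
    then have "K (t - s) s = 0" for s by (auto simp: K_def)
    then show ?thesis using False by (simp add: G_def)
  qed
  show L1: "D_L1 \<mu> f \<in> L1"
    using G_int by (simp add: L1_def set_integrable_def D_eq)
  show "Dbar \<mu> (L1_measure f) = L1_measure (D_L1 \<mu> f)"
  proof (rule finite_measure_eqI)
    show "Dbar \<mu> (L1_measure f) \<in> finite_measures" "L1_measure (D_L1 \<mu> f) \<in> finite_measures"
      by (intro Dbar_in_finite_measures L1_measure_in_finite_measures f L1)+
    fix h assume h: "h \<in> bounded_borel"
    note [measurable] = bounded_borel_measurable[OF h]
    have "cint (Dbar \<mu> (L1_measure f)) {0..<1} h = (\<integral>x. deriv_transpose h x * g x \<partial>lborel)"
      using cint_L1_measure[OF f bounded_borel_deriv_transpose[OF h]]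
      by (simp add: cint_Dbar[OF L1_measure_in_finite_measures[OF f] h] g_def)
    also have "\<dots> = (\<integral>x. \<integral>s. h (x + s) * K x s \<partial>mass \<mu> \<partial>lborel)"
    proof (intro Bochner_Integration.integral_cong refl)
      fix x
      show "deriv_transpose h x * g x = (\<integral>s. h (x + s) * K x s \<partial>mass \<mu>)"
      proof (cases "x \<in> {0..<1}")
        case True
        have "deriv_transpose h x * g x =
            (\<integral>s. of_real x * g x * (indicator {0..<1 - x} s *\<^sub>R (h (x + s) * dens \<mu> s)) \<partial>mass \<mu>)"
          using conv_transpose_eq[OF bounded_borel_measurable[OF h] True]
          by (simp only: deriv_transpose_def integral_mult_right_zero) (simp only: mult_ac)
        also have "\<dots> = (\<integral>s. h (x + s) * K x s \<partial>mass \<mu>)"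
          using True by (intro Bochner_Integration.integral_cong) (auto simp: K_def indicator_def)
        finally show ?thesis .
      next
        case False
        then have "K x s = 0" for s by (auto simp: K_def g_def)
        then show ?thesis using False by (simp add: g_def)
      qed
    qed
    also have "\<dots> = (\<integral>s. \<integral>x. h (x + s) * K x s \<partial>lborel \<partial>mass \<mu>)"
      by (rule Fubini_integral[OF K_int[OF h], symmetric])
    also have "\<dots> = (\<integral>s. \<integral>t. h t * K (t - s) s \<partial>lborel \<partial>mass \<mu>)"
    proof (rule Bochner_Integration.integral_cong[OF refl])
      fix s
      show "(\<integral>x. h (x + s) * K x s \<partial>lborel) = (\<integral>t. h t * K (t - s) s \<partial>lborel)"
        using shift[of "\<lambda>t. h t * K (t - s) s" s] by simp
    qed
    also have "\<dots> = (\<integral>t. \<integral>s. h t * K (t - s) s \<partial>mass \<mu> \<partial>lborel)"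
      by (rule Fubini_integral[OF Kt_int[OF h]])
    also have "\<dots> = (\<integral>t. h t * G t \<partial>lborel)"
      by (simp add: G_def)
    also have "\<dots> = cint (L1_measure (D_L1 \<mu> f)) {0..<1} h"
      by (simp add: cint_L1_measure[OF L1 h] D_eq)
    finally show "cint (Dbar \<mu> (L1_measure f)) {0..<1} h = cint (L1_measure (D_L1 \<mu> f)) {0..<1} h" .
  qed
qed

end

section \<open>The extension theorem, with the growth bound carried from near 0 to (0,1)\<close>

theorem proposition2p1:
  fixes \<mu> :: cmeasure
  assumes "\<mu> \<in> locally_finite_measures"
    and "Bfun (\<lambda>t. t * measure (variation \<mu>) {0..<1 - t}) (at_right 0)"
  shows "(\<forall>\<nu>\<in>finite_measures. convolution (Xmult \<nu>) \<mu> \<in> finite_measures) \<and>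
    (\<forall>f\<in>L1. D_L1 \<mu> f \<in> L1 \<and> Dbar \<mu> (L1_measure f) = L1_measure (D_L1 \<mu> f)) \<and>
    derivation_on_M (Dbar \<mu>) \<and>
    bounded_on_M (Dbar \<mu>) \<and>
    continuous_map weak_star weak_star (Dbar \<mu>)"
proof -
  interpret lfin_measure \<mu> by unfold_locales fact
  obtain K where "eventually (\<lambda>t. norm (t * measure (variation \<mu>) {0..<1 - t}) \<le> K) (at_right 0)"
    using assms(2) by (rule BfunE)
  then obtain d where d: "0 < d" "\<And>t. 0 < t \<Longrightarrow> t < d \<Longrightarrow> norm (t * measure (variation \<mu>) {0..<1 - t}) \<le> K"
    by (auto simp: eventually_at_right_field)
  \<comment> \<open>For t >= d the interval [0,1 - t) lies in [0,a), whose mass is finite because a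
    < 1; this complements the bound K, valid for t < d.\<close>
  define a where "a = 1 - d"
  have "a < 1" using d(1) by (simp add: a_def)
  then have a: "{0..<a} \<in> borel01" "{0..a} \<in> borel01"
    by (auto simp: borel01_iff)
  define M where "M = measure (variation \<mu>) {0..<a}"
  have "t * measure (variation \<mu>) {0..<1 - t} \<le> max K M" if t: "0 < t" "t < 1" for t
  proof (cases "t < d")
    case True
    then show ?thesis using abs_le_D1[OF d(2)[OF t(1) True, unfolded real_norm_def]] by simp
  next
    case False
    have "emeasure (variation \<mu>) {0..<a} \<le> variation_on \<mu> {0..a}"
      unfolding emeasure_variation[OF a(1)] by (intro variation_on_mono a) auto
    also have "\<dots> < \<infinity>"
      using \<open>a < 1\<close> by (rule variation_on_compact_finite)
    finally have "{0..<a} \<in> fmeasurable (variation \<mu>)"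
      using a by (intro fmeasurableI) simp_all
    then have "measure (variation \<mu>) {0..<1 - t} \<le> M"
      unfolding M_def using False t by (intro measure_mono_fmeasurable) (auto simp: borel01_iff a_def)
    moreover have "t * measure (variation \<mu>) {0..<1 - t} \<le> 1 * measure (variation \<mu>) {0..<1 - t}"
      using t by (intro mult_right_mono) auto
    ultimately show ?thesis by simp
  qed
  then interpret volterra_measure \<mu> "max K M"
    by unfold_locales
  show ?thesis
    using Dbar_in_finite_measures D_L1_in_L1 Dbar_L1_measure derivation_on_M_Dbar bounded_on_M_Dbar continuous_map_Dbar
    by (auto simp: Dbar_def)
qed

end
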